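(* Let $G=(V,E)$ be a finite graph and let $\mathbf J,\tilde{\mathbf J}$ be ferromagnetic pair interactions on $G$ with $0\le J_{uv}\le\tilde J_{uv}$ for every $uv\in E$. Let $(\lambda_u)_{u\in V}$ be nonnegative real numbers. Let $\alpha_1(\mathbf J)$ (resp. $\alpha_1(\tilde{\mathbf J})$) be the smallest modulus of a zero of the entire function $h\mapsto\big\langle\exp\big[h\sum_{u\in V}\lambda_u\sigma_u\big]\big\rangle_{G,\mathbf J}$, $h\in\mathbb C$ (resp. of the same function with $\tilde{\mathbf J}$ in place of $\mathbf J$), with the convention that it is $+\infty$ if there is no zero. Then $\alpha_1(\mathbf J)\ge\alpha_1(\tilde{\mathbf J})$.
   Context: The Ising model on a finite graph $G=(V,E)$ with interactions $\mathbf J=(J_{uv})_{uv\in E}$, $J_{uv}\ge 0$, is the probability measure on $\{-1,+1\}^V$ given by $\mathbb P_{G,\mathbf J}(\sigma)=\exp\big[\sum_{uv\in E}J_{uv}\sigma_u\sigma_v\big]/Z_G$, where $Z_G$ is the normalizing constant; $\langle\cdot\rangle_{G,\mathbf J}$ denotes expectation with respect to it. *)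

theory Defs
  imports Complex_Main "HOL-Library.FuncSet" "HOL-Library.Extended_Real"
begin

definition simple_graph :: "'a set \<Rightarrow> 'a set set \<Rightarrow> bool" where
  "simple_graph V E \<longleftrightarrow> finite V \<and> (\<forall>e\<in>E. e \<subseteq> V \<and> card e = 2)"

definition spin_configs :: "'a set \<Rightarrow> ('a \<Rightarrow> real) set" where
  "spin_configs V = (V \<rightarrow>\<^sub>E {-1, 1})"

definition ising_weight :: "'a set set \<Rightarrow> ('a set \<Rightarrow> real) \<Rightarrow> ('a \<Rightarrow> real) \<Rightarrow> real" where
  "ising_weight E J \<sigma> = exp (\<Sum>e\<in>E. J e * (\<Prod>x\<in>e. \<sigma> x))"

definition ising_Z :: "'a set \<Rightarrow> 'a set set \<Rightarrow> ('a set \<Rightarrow> real) \<Rightarrow> real" where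
  "ising_Z V E J = (\<Sum>\<sigma>\<in>spin_configs V. ising_weight E J \<sigma>)"

definition ising_mgf ::
  "'a set \<Rightarrow> 'a set set \<Rightarrow> ('a set \<Rightarrow> real) \<Rightarrow> ('a \<Rightarrow> real) \<Rightarrow> complex \<Rightarrow> complex" where
  "ising_mgf V E J lam h =
     (\<Sum>\<sigma>\<in>spin_configs V. complex_of_real (ising_weight E J \<sigma>)
         * exp (h * complex_of_real (\<Sum>u\<in>V. lam u * \<sigma> u))) / complex_of_real (ising_Z V E J)"

text \<open>Smallest modulus of a zero (infimum in the extended reals; +\<infinity> if there is no zero).\<close>
definition alpha1 ::
  "'a set \<Rightarrow> 'a set set \<Rightarrow> ('a set \<Rightarrow> real) \<Rightarrow> ('a \<Rightarrow> real) \<Rightarrow> ereal" where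
  "alpha1 V E J lam = Inf {ereal (cmod h) | h. ising_mgf V E J lam h = 0}"

end

(*
Put h = i theta and let f_J be the unnormalised partition function as a power series in theta. Its
smallest zero modulus is the radius of convergence of 1/f_J. So it is enough that 1/f_J and, for
J <= J', the quotient f_J/f_J' have nonnegative coefficients: then 1/f_J' = (f_J/f_J') (1/f_J)
dominates a positive multiple of 1/f_J coefficientwise.

These signs are proved degree by degree, for all regions W and couplings at once, together with those
of -i<s_v> (nonnegative) and of <s_u s_v> (nonpositive except for the constant term), where <.> is the
complex expectation at imaginary field. The derivatives in theta of these expectations are truncated
correlations. Doubling the system and reversing the spins of the second replica on D, a truncated
correlation with s_w becomes a sum over D containing w in which the field acts only outside D.
Exploring the cluster of the marked vertices inside D (as in the Fortuin-Kasteleyn expansion, with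
nonnegative weights) turns it into a nonnegative combination of f_E^2 or f_E (f_E <s_v>_E), E a subset
of W. Dividing by f_W^2 leaves the quotients f_E/f_W, whose signs are known in lower degree; these
quotients in turn arise by lowering the couplings, where <s_u s_v> enters.
*)
theory Submission
  imports Defs "HOL-Complex_Analysis.Cauchy_Integral_Formula"
begin

subsection \<open>Spins and energies\<close>

text \<open>A configuration is encoded by the set of its minus spins; the product of two configurations is
  then the symmetric difference.\<close>

definition spin :: "'a set \<Rightarrow> 'a \<Rightarrow> real" where
  "spin A x = (if x \<in> A then -1 else 1)"

lemma spin_sym_diff: "spin (sym_diff A B) x = spin A x * spin B x"
  by (auto simp: spin_def)

text \<open>The sum runs over ordered pairs of a coupling that need not be symmetric, so that a
  single entry of \<open>j\<close> can be changed on its own. Diagonal entries only add a constant,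
  as spins square to 1.\<close>

definition energy :: "('a \<Rightarrow> 'a \<Rightarrow> real) \<Rightarrow> 'a set \<Rightarrow> 'a set \<Rightarrow> real" where
  "energy j W A = (\<Sum>x\<in>W. \<Sum>y\<in>W. j x y * (spin A x * spin A y))"

definition cross_energy :: "('a \<Rightarrow> 'a \<Rightarrow> real) \<Rightarrow> 'a set \<Rightarrow> 'a set \<Rightarrow> 'a set \<Rightarrow> real" where
  "cross_energy j U D A = (\<Sum>x\<in>D. \<Sum>y\<in>U. (j x y + j y x) * (spin A x * spin A y))"

definition field_energy :: "('a \<Rightarrow> real) \<Rightarrow> 'a set \<Rightarrow> 'a set \<Rightarrow> real" where
  "field_energy lam W A = (\<Sum>x\<in>W. lam x * spin A x)"

lemma spin_cong: "A \<inter> W = B \<inter> W \<Longrightarrow> x \<in> W \<Longrightarrow> spin A x = spin B x"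
  by (auto simp: spin_def)

lemma energy_cong: "A \<inter> W = B \<inter> W \<Longrightarrow> energy j W A = energy j W B"
  unfolding energy_def by (intro sum.cong refl) (metis spin_cong)

lemma field_energy_cong: "A \<inter> W = B \<inter> W \<Longrightarrow> field_energy lam W A = field_energy lam W B"
  unfolding field_energy_def by (intro sum.cong refl) (metis spin_cong)

lemma energy_empty [simp]: "energy j {} A = 0"
  by (simp add: energy_def)

lemma cross_energy_empty [simp]: "cross_energy j {} D A = 0" "cross_energy j U {} A = 0"
  by (simp_all add: cross_energy_def)

lemma energy_Un:
  assumes "finite U" "finite D" "U \<inter> D = {}"
  shows "energy j (U \<union> D) A = energy j U A + cross_energy j U D A + energy j D A"
proof -
  have "energy j (U \<union> D) A = energy j U A + (\<Sum>x\<in>U. \<Sum>y\<in>D. j x y * (spin A x * spin A y))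
     + (\<Sum>x\<in>D. \<Sum>y\<in>U. j x y * (spin A x * spin A y)) + energy j D A"
    using assms by (simp add: energy_def sum.union_disjoint sum.distrib)
  moreover have "(\<Sum>x\<in>U. \<Sum>y\<in>D. j x y * (spin A x * spin A y))
      = (\<Sum>x\<in>D. \<Sum>y\<in>U. j y x * (spin A x * spin A y))"
    by (subst sum.swap) (simp add: mult.commute)
  ultimately show ?thesis
    by (simp add: cross_energy_def sum.distrib algebra_simps)
qed

lemma field_energy_Un:
  assumes "finite U" "finite D" "U \<inter> D = {}"
  shows "field_energy lam (U \<union> D) A = field_energy lam U A + field_energy lam D A"
  using assms by (simp add: field_energy_def sum.union_disjoint)

text \<open>For two replicas that differ exactly on \<open>D\<close>, the field cancels on \<open>D\<close>, and the interaction across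
  the boundary of \<open>D\<close> cancels as well.\<close>

lemma energy_replica:
  assumes "finite W" "D \<subseteq> W"
  shows "energy j W A + energy j W (sym_diff A D) = 2 * energy j D A + 2 * energy j (W - D) A"
proof -
  have W: "W = D \<union> (W - D)" and fin: "finite D" "finite (W - D)" and dis: "D \<inter> (W - D) = {}"
    using assms by (auto intro: finite_subset)
  have "energy j D (sym_diff A D) = energy j D A"
    "energy j (W - D) (sym_diff A D) = energy j (W - D) A"
    by (auto simp: energy_def spin_sym_diff intro!: sum.cong) (auto simp: spin_def)
  moreover have "cross_energy j D (W - D) (sym_diff A D) = - cross_energy j D (W - D) A"
    unfolding cross_energy_def sum_negf [symmetric]
    by (intro sum.cong refl) (auto simp: spin_sym_diff spin_def)
  ultimately show ?thesis
    by (subst (1 2) W) (simp only: energy_Un [OF fin dis])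
qed

lemma field_energy_replica:
  assumes "finite W" "D \<subseteq> W"
  shows "field_energy lam W A + field_energy lam W (sym_diff A D) = 2 * field_energy lam (W - D) A"
proof -
  have W: "W = D \<union> (W - D)" and fin: "finite D" "finite (W - D)" and dis: "D \<inter> (W - D) = {}"
    using assms by (auto intro: finite_subset)
  have "field_energy lam (W - D) (sym_diff A D) = field_energy lam (W - D) A"
    unfolding field_energy_def by (intro sum.cong refl) (auto simp: spin_def)
  moreover have "field_energy lam D (sym_diff A D) = - field_energy lam D A"
    unfolding field_energy_def sum_negf [symmetric]
    by (intro sum.cong refl) (auto simp: spin_def)
  ultimately show ?thesis
    by (subst (1 2) W) (simp only: field_energy_Un [OF fin dis])
qed

section \<open>Reindexing sums over sets of minus spins\<close>

lemma sum_Pow_Un: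
  fixes F :: "'a set \<Rightarrow> 'b :: comm_monoid_add"
  assumes "S \<inter> D = {}"
  shows "(\<Sum>A\<in>Pow (S \<union> D). F A) = (\<Sum>B\<in>Pow S. \<Sum>C\<in>Pow D. F (B \<union> C))"
proof -
  have "(\<Sum>B\<in>Pow S. \<Sum>C\<in>Pow D. F (B \<union> C)) = (\<Sum>(B, C)\<in>Pow S \<times> Pow D. F (B \<union> C))"
    by (simp add: sum.cartesian_product)
  also have "\<dots> = (\<Sum>A\<in>Pow (S \<union> D). F A)"
    using assms
    by (intro sum.reindex_bij_witness [where i = "\<lambda>A. (A \<inter> S, A \<inter> D)" and j = "\<lambda>(B, C). B \<union> C"]) auto
  finally show ?thesis ..
qed

lemma sum_Pow_sym_diff:
  assumes "A \<subseteq> W"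
  shows "(\<Sum>B\<in>Pow W. F (sym_diff A B)) = (\<Sum>B\<in>Pow W. F B)"
  using assms
  by (intro sum.reindex_bij_witness [where i = "sym_diff A" and j = "sym_diff A"]) auto

lemma sum_Pow_Pow_diff:
  fixes F :: "'a set \<Rightarrow> 'a set \<Rightarrow> 'b :: comm_monoid_add"
  assumes "finite E"
  shows "(\<Sum>D\<in>Pow E. \<Sum>B\<in>Pow D. F B (D - B)) = (\<Sum>B\<in>Pow E. \<Sum>D\<in>Pow (E - B). F B D)"
proof -
  have fin: "finite (Pow D)" if "D \<in> Pow E" for D
    using that assms finite_subset by auto
  have "(\<Sum>D\<in>Pow E. \<Sum>B\<in>Pow D. F B (D - B)) = (\<Sum>(D, B)\<in>Sigma (Pow E) Pow. F B (D - B))"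
    using assms fin by (subst sum.Sigma) auto
  also have "\<dots> = (\<Sum>(B, D)\<in>Sigma (Pow E) (\<lambda>B. Pow (E - B)). F B D)"
    by (intro sum.reindex_bij_witness [where i = "\<lambda>(B, D). (B \<union> D, B)" and j = "\<lambda>(D, B). (B, D - B)"]) auto
  also have "\<dots> = (\<Sum>B\<in>Pow E. \<Sum>D\<in>Pow (E - B). F B D)"
    using assms by (subst sum.Sigma) auto
  finally show ?thesis .
qed

subsection \<open>Exploring clusters in zero field\<close>

text \<open>Functions with nonnegative Fourier coefficients on the group of configurations.\<close>

inductive positive_type :: "('a set \<Rightarrow> real) \<Rightarrow> bool" where
  character: "(\<And>A B. m (sym_diff A B) = m A * m B) \<Longrightarrow> 0 \<le> c \<Longrightarrow> positive_type (\<lambda>A. c * m A)"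
| add: "positive_type f \<Longrightarrow> positive_type g \<Longrightarrow> positive_type (\<lambda>A. f A + g A)"

lemma positive_type_const: "0 \<le> c \<Longrightarrow> positive_type (\<lambda>A. c)"
  using positive_type.character [of "\<lambda>_. 1" c] by simp

lemma positive_type_spin_spin: "positive_type (\<lambda>A. spin A x * spin A y)"
  using positive_type.character [of "\<lambda>A. spin A x * spin A y" 1] by (simp add: spin_sym_diff)

lemma positive_type_mult_character:
  assumes "positive_type g" "\<And>A B. m (sym_diff A B) = m A * m B" "0 \<le> c"
  shows "positive_type (\<lambda>A. c * m A * g A)"
  using assms(1)
proof induction
  case (character m' c')
  then show ?case
    using positive_type.character [of "\<lambda>A. m A * m' A" "c * c'"] assms(2,3)
    by (simp add: mult.assoc mult.left_commute)
next
  case (add f g)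
  then show ?case
    using positive_type.add by (fastforce simp: distrib_left)
qed

lemma positive_type_mult:
  assumes "positive_type f" "positive_type g"
  shows "positive_type (\<lambda>A. f A * g A)"
  using assms(1)
proof induction
  case (character m c)
  then show ?case
    by (rule positive_type_mult_character [OF assms(2)])
next
  case (add f1 f2)
  then show ?case
    using positive_type.add by (fastforce simp: distrib_right)
qed

text \<open>Orthogonality of characters: if \<open>m T\<close> differs from 1 for some
  \<open>T\<close> inside \<open>S\<close>, translating by \<open>T\<close> multiplies the sum of
  \<open>m\<close> by \<open>m T\<close>, so the sum is 0. Otherwise \<open>m\<close> is constantly
  1 there.\<close>

lemma positive_type_sum_nonneg:
  assumes "positive_type g" "finite S"
  shows "0 \<le> (\<Sum>A\<in>Pow S. g A)"
  using assms(1)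
proof induction
  case (character m c)
  have "0 \<le> (\<Sum>A\<in>Pow S. m A)"
  proof (cases "\<forall>T\<in>Pow S. m T = 1")
    case False
    then obtain T where T: "T \<subseteq> S" "m T \<noteq> 1" by auto
    have "(\<Sum>A\<in>Pow S. m A) = (\<Sum>A\<in>Pow S. m (sym_diff T A))"
      by (rule sum_Pow_sym_diff [OF T(1), symmetric])
    also have "\<dots> = m T * (\<Sum>A\<in>Pow S. m A)"
      by (simp only: character sum_distrib_left)
    finally show ?thesis using T(2) by simp
  qed simp
  then show ?case
    using character by (simp add: sum_distrib_left [symmetric])
next
  case (add f g)
  then show ?case by (simp add: sum.distrib)
qed

lemma positive_type_prod:
  "finite B \<Longrightarrow> (\<And>x. x \<in> B \<Longrightarrow> positive_type (f x)) \<Longrightarrow> positive_type (\<lambda>A. \<Prod>x\<in>B. f x A)"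
  by (induction B rule: finite_induct) (auto intro: positive_type_const positive_type_mult)

text \<open>With a = exp f - 1 and b = exp g - 1 the claim concerns ab + a + b. The subtracted 1 is
  kept throughout because the cluster expansion uses the factors exp - 1, not exp.\<close>

lemma positive_type_exp_minus_one_add:
  assumes "positive_type (\<lambda>A. exp (f A) - 1)" "positive_type (\<lambda>A. exp (g A) - 1)"
  shows "positive_type (\<lambda>A. exp (f A + g A) - (1::real))"
proof -
  have eq: "exp (f A + g A) - (1::real)
      = ((exp (f A) - 1) * (exp (g A) - 1) + (exp (f A) - 1)) + (exp (g A) - 1)" for A
    by (simp add: exp_add algebra_simps)
  show ?thesis
    unfolding eq by (intro positive_type.add positive_type_mult assms)
qed

lemma exp_mult_spin_spin:
  "exp (k * (spin A x * spin A y)) = cosh k + sinh k * (spin A x * spin A y)"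
  by (auto simp: spin_def cosh_def sinh_def field_simps)

text \<open>The Fourier coefficients are cosh k - 1 and sinh k; this is where ferromagnetism
  enters.\<close>

lemma positive_type_exp_minus_one_spin_spin:
  assumes "0 \<le> k"
  shows "positive_type (\<lambda>A. exp (k * (spin A x * spin A y)) - 1)"
proof -
  have "positive_type (\<lambda>A. (cosh k - 1) + sinh k * (spin A x * spin A y))"
    using assms cosh_real_ge_1 [of k]
    by (intro positive_type.add positive_type_const positive_type_mult positive_type_spin_spin) auto
  then show ?thesis
    by (simp add: exp_mult_spin_spin algebra_simps)
qed

lemma positive_type_exp_minus_one_sum:
  "finite B \<Longrightarrow> (\<And>x. x \<in> B \<Longrightarrow> positive_type (\<lambda>A. exp (f x A) - (1::real)))
    \<Longrightarrow> positive_type (\<lambda>A. exp (\<Sum>x\<in>B. f x A) - 1)"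
proof (induction B rule: finite_induct)
  case empty
  then show ?case using positive_type_const [of 0] by simp
next
  case (insert x B)
  then show ?case
    using positive_type_exp_minus_one_add [of "f x" "\<lambda>A. \<Sum>x\<in>B. f x A"] by simp
qed

lemma positive_type_exp_energy:
  assumes "finite B" "\<And>x y. 0 \<le> j x y"
  shows "positive_type (\<lambda>A. exp (2 * energy j B A))"
proof -
  have "positive_type (\<lambda>A. exp (\<Sum>x\<in>B. \<Sum>y\<in>B. (2 * j x y) * (spin A x * spin A y)) - 1)"
    using assms
    by (intro positive_type_exp_minus_one_sum positive_type_exp_minus_one_spin_spin) auto
  then have "positive_type (\<lambda>A. (exp (2 * energy j B A) - 1) + 1)"
    by (intro positive_type.add positive_type_const)
       (simp_all add: energy_def sum_distrib_left mult.assoc)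
  then show ?thesis by simp
qed

section \<open>Layer-by-layer exploration at doubled coupling in zero field\<close>

definition free_sum :: "('a \<Rightarrow> 'a \<Rightarrow> real) \<Rightarrow> 'a set \<Rightarrow> ('a set \<Rightarrow> real) \<Rightarrow> real" where
  "free_sum j D c = (\<Sum>A\<in>Pow D. c A * exp (2 * energy j D A))"

text \<open>Here \<open>S\<close> is the region explored so far, and only its last layer \<open>U\<close> still interacts with the
  unexplored region \<open>D\<close>. Writing each factor \<open>exp k\<close> across \<open>U\<close> and \<open>D\<close> as \<open>1 + (exp k - 1)\<close> selects the next layer.\<close>

definition layered_sum ::
  "('a \<Rightarrow> 'a \<Rightarrow> real) \<Rightarrow> 'a set \<Rightarrow> 'a set \<Rightarrow> ('a set \<Rightarrow> real) \<Rightarrow> 'a set \<Rightarrow> real" where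
  "layered_sum j S U g D =
    (\<Sum>A\<in>Pow (S \<union> D). g A * exp (2 * cross_energy j U D A) * exp (2 * energy j D A))"

text \<open>The weight absorbed when \<open>B\<close> is the next layer: a factor exp - 1 for each
  vertex of \<open>B\<close> joined to \<open>U\<close>, and the interaction inside
  \<open>B\<close>. The interaction of \<open>B\<close> with the rest is left out, since it is the
  cross energy of the next stage.\<close>

definition next_layer ::
  "('a \<Rightarrow> 'a \<Rightarrow> real) \<Rightarrow> 'a set \<Rightarrow> ('a set \<Rightarrow> real) \<Rightarrow> 'a set \<Rightarrow> 'a set \<Rightarrow> real" where
  "next_layer j U g B A = g A
     * (\<Prod>x\<in>B. exp (\<Sum>y\<in>U. 2 * (j x y + j y x) * (spin A x * spin A y)) - 1)
     * exp (2 * energy j B A)"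

lemma layered_sum_expand:
  assumes "finite D" "finite S" "S \<inter> D = {}"
  shows "layered_sum j S U g D =
    (\<Sum>B\<in>Pow D. layered_sum j (S \<union> B) B (next_layer j U g B) (D - B))"
proof -
  define e where "e A x = exp (\<Sum>y\<in>U. 2 * (j x y + j y x) * (spin A x * spin A y)) - (1::real)" for A x
  have cross: "exp (2 * cross_energy j U D A) = (\<Sum>B\<in>Pow D. \<Prod>x\<in>B. e A x)" for A
  proof -
    have "exp (2 * cross_energy j U D A) = (\<Prod>x\<in>D. e A x + 1)"
      using assms by (simp add: cross_energy_def e_def sum_distrib_left exp_sum mult.assoc [symmetric])
    also have "\<dots> = (\<Sum>B\<in>Pow D. \<Prod>x\<in>B. e A x)"
      using assms(1) by (subst prod_add) simp_all
    finally show ?thesis .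
  qed
  have layer: "g A * (\<Prod>x\<in>B. e A x) * exp (2 * energy j D A)
      = next_layer j U g B A * exp (2 * cross_energy j B (D - B) A) * exp (2 * energy j (D - B) A)"
    if "B \<in> Pow D" for A B
  proof -
    have "D = B \<union> (D - B)" "finite B" "finite (D - B)"
      using that assms(1) by (auto intro: finite_subset)
    then have "energy j D A = energy j B A + cross_energy j B (D - B) A + energy j (D - B) A"
      by (metis energy_Un Diff_disjoint)
    then show ?thesis
      by (simp add: next_layer_def e_def exp_add algebra_simps)
  qed
  have "layered_sum j S U g D
      = (\<Sum>A\<in>Pow (S \<union> D). \<Sum>B\<in>Pow D. g A * (\<Prod>x\<in>B. e A x) * exp (2 * energy j D A))"
    by (simp add: layered_sum_def cross sum_distrib_left sum_distrib_right)
  also have "\<dots> = (\<Sum>B\<in>Pow D. \<Sum>A\<in>Pow (S \<union> D). next_layer j U g B A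
      * exp (2 * cross_energy j B (D - B) A) * exp (2 * energy j (D - B) A))"
    by (subst sum.swap) (auto intro!: sum.cong simp: layer)
  also have "\<dots> = (\<Sum>B\<in>Pow D. layered_sum j (S \<union> B) B (next_layer j U g B) (D - B))"
    unfolding layered_sum_def
    by (intro sum.cong refl) (auto intro!: arg_cong2 [where f = sum])
  finally show ?thesis .
qed

text \<open>Keeps the weight a function of the explored spins alone, which permits the factorisation
  once exploration stops.\<close>

lemma next_layer_local:
  assumes "\<And>A. g A = g (A \<inter> S)" "U \<subseteq> S"
  shows "next_layer j U g B A = next_layer j U g B (A \<inter> (S \<union> B))"
proof -
  have "g A = g (A \<inter> (S \<union> B))"
    using assms(1) [of A] assms(1) [of "A \<inter> (S \<union> B)"] by (simp add: Int_assoc)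
  moreover have "energy j B A = energy j B (A \<inter> (S \<union> B))"
    by (rule energy_cong) auto
  moreover have "(\<Prod>x\<in>B. exp (\<Sum>y\<in>U. 2 * (j x y + j y x) * (spin A x * spin A y)) - (1::real))
    = (\<Prod>x\<in>B. exp (\<Sum>y\<in>U. 2 * (j x y + j y x)
        * (spin (A \<inter> (S \<union> B)) x * spin (A \<inter> (S \<union> B)) y)) - 1)"
    using assms(2) by (intro prod.cong sum.cong arg_cong2 [where f = minus] arg_cong [where f = exp] refl)
      (auto simp: spin_def)
  ultimately show ?thesis by (simp add: next_layer_def)
qed

lemma positive_type_next_layer:
  assumes "positive_type g" "\<And>x y. 0 \<le> j x y" "finite U" "finite B"
  shows "positive_type (next_layer j U g B)"
proof -
  have "positive_type (\<lambda>A. next_layer j U g B A)"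
    unfolding next_layer_def
    using assms
    by (intro positive_type_mult positive_type_prod positive_type_exp_energy
        positive_type_exp_minus_one_sum positive_type_exp_minus_one_spin_spin) auto
  then show ?thesis .
qed

text \<open>With an empty last layer nothing links \<open>S\<close> to \<open>D\<close>:
  \<open>g\<close> sees only \<open>S\<close> and the energy sees only \<open>D\<close>.\<close>

lemma layered_sum_no_layer:
  assumes "\<And>A. g A = g (A \<inter> S)" "S \<inter> D = {}"
  shows "layered_sum j S {} g D = (\<Sum>A\<in>Pow S. g A) * free_sum j D (\<lambda>_. 1)"
proof -
  have "g (B \<union> C) * exp (2 * energy j D (B \<union> C)) = g B * exp (2 * energy j D C)"
    if "B \<in> Pow S" "C \<in> Pow D" for B C
  proof -
    have "(B \<union> C) \<inter> S = B" "(B \<union> C) \<inter> D = C \<inter> D" using that assms(2) by auto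
    then show ?thesis by (metis assms(1) energy_cong)
  qed
  then show ?thesis
    using assms(2) by (simp add: layered_sum_def sum_Pow_Un free_sum_def sum_product)
qed

section \<open>Exploration inside a cone of power series\<close>

lemma fps_const_sum: "fps_const (\<Sum>x\<in>I. f x) = (\<Sum>x\<in>I. fps_const (f x :: 'b :: comm_monoid_add))"
  by (induction I rule: infinite_finite_induct) (simp_all flip: fps_const_add)

text \<open>An abstract cone lets one exploration argument serve both truncated correlations; later
  it consists of the series whose product with a fixed series has nonnegative coefficients up to a
  given degree.\<close>

definition fps_cone :: "(complex fps \<Rightarrow> bool) \<Rightarrow> bool" where
  "fps_cone C \<longleftrightarrow> C 0 \<and> (\<forall>F G. C F \<longrightarrow> C G \<longrightarrow> C (F + G))
     \<and> (\<forall>r::real. \<forall>F. 0 \<le> r \<longrightarrow> C F \<longrightarrow> C (fps_const (of_real r) * F))"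

lemma fps_cone_sum: "fps_cone C \<Longrightarrow> (\<And>x. x \<in> I \<Longrightarrow> C (F x)) \<Longrightarrow> C (\<Sum>x\<in>I. F x)"
  by (induction I rule: infinite_finite_induct) (auto simp: fps_cone_def)

text \<open>Once no further layer is chosen, the rest of the region is free, and the sum over it is one of the
  generators in the last assumption; all weights that occur are nonnegative.\<close>

lemma layered_sum_in_cone:
  assumes "fps_cone C" and j: "\<And>x y. 0 \<le> j x y"
    and "finite E" "finite S" "S \<inter> E = {}" "U \<subseteq> S"
    and "positive_type g" "\<And>A. g A = g (A \<inter> S)"
    and "\<And>E'. E' \<subseteq> E \<Longrightarrow> C (\<Sum>D\<in>Pow E'. fps_const (of_real (free_sum j D (\<lambda>_. 1))) * \<Phi> (E' - D))"
  shows "C (\<Sum>D\<in>Pow E. fps_const (of_real (layered_sum j S U g D)) * \<Phi> (E - D))"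
  using assms(3-)
proof (induction "card E" arbitrary: E S U g rule: less_induct)
  case less
  have finU: "finite U" using less.prems finite_subset by blast
  \<comment> \<open>Writing \<open>E - D\<close> as \<open>E - B - (D - B)\<close> makes the term of
    each layer \<open>B\<close>, after the sums are exchanged, an instance of the same shape on
    \<open>E - B\<close>.\<close>
  have "(\<Sum>D\<in>Pow E. fps_const (of_real (layered_sum j S U g D)) * \<Phi> (E - D))
     = (\<Sum>D\<in>Pow E. \<Sum>B\<in>Pow D. fps_const (of_real
          (layered_sum j (S \<union> B) B (next_layer j U g B) (D - B))) * \<Phi> (E - B - (D - B)))"
  proof (intro sum.cong refl)
    fix D assume D: "D \<in> Pow E"
    then have "finite D" "S \<inter> D = {}" using less.prems finite_subset by auto
    moreover have "E - B - (D - B) = E - D" if "B \<in> Pow D" for B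
      using that by auto
    ultimately show "fps_const (of_real (layered_sum j S U g D)) * \<Phi> (E - D)
      = (\<Sum>B\<in>Pow D. fps_const (of_real
          (layered_sum j (S \<union> B) B (next_layer j U g B) (D - B))) * \<Phi> (E - B - (D - B)))"
      using less.prems(2)
      by (simp add: layered_sum_expand fps_const_sum sum_distrib_right [symmetric])
  qed
  also have "\<dots> = (\<Sum>B\<in>Pow E. \<Sum>D\<in>Pow (E - B). fps_const (of_real
          (layered_sum j (S \<union> B) B (next_layer j U g B) D)) * \<Phi> (E - B - D))"
    by (rule sum_Pow_Pow_diff [OF less.prems(1)])
  also have "C \<dots>"
  proof (rule fps_cone_sum [OF assms(1)])
    fix B assume B: "B \<in> Pow E"
    show "C (\<Sum>D\<in>Pow (E - B). fps_const (of_real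
          (layered_sum j (S \<union> B) B (next_layer j U g B) D)) * \<Phi> (E - B - D))"
    proof (cases "B = {}")
      case True
      have "next_layer j U g {} = g"
        by (simp add: next_layer_def fun_eq_iff)
      moreover have "layered_sum j S {} g D = (\<Sum>A\<in>Pow S. g A) * free_sum j D (\<lambda>_. 1)"
        if "D \<in> Pow E" for D
        using that less.prems by (intro layered_sum_no_layer) auto
      ultimately have "(\<Sum>D\<in>Pow (E - B). fps_const (of_real
          (layered_sum j (S \<union> B) B (next_layer j U g B) D)) * \<Phi> (E - B - D))
        = fps_const (of_real (\<Sum>A\<in>Pow S. g A))
          * (\<Sum>D\<in>Pow E. fps_const (of_real (free_sum j D (\<lambda>_. 1))) * \<Phi> (E - D))"
        using True by (simp add: sum_distrib_left fps_const_mult [symmetric] mult.assoc del: of_real_sum fps_const_mult)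
      then show ?thesis
        using assms(1) less.prems(7) [of E] positive_type_sum_nonneg [OF less.prems(5,2)]
        by (simp add: fps_cone_def del: of_real_sum)
    next
      case False
      have "finite B" using B less.prems(1) finite_subset by auto
      \<comment> \<open>A nonempty layer strictly shrinks the unexplored region, so the induction
        hypothesis applies with \<open>B\<close> as the new last layer.\<close>
      show ?thesis
      proof (rule less.hyps)
        show "card (E - B) < card E"
          using B False less.prems(1) by (intro psubset_card_mono) auto
        show "positive_type (next_layer j U g B)"
          using less.prems j finU \<open>finite B\<close> by (intro positive_type_next_layer) auto
        show "next_layer j U g B A = next_layer j U g B (A \<inter> (S \<union> B))" for A
          using less.prems by (intro next_layer_local) auto
        show "C (\<Sum>D\<in>Pow E'. fps_const (of_real (free_sum j D (\<lambda>_. 1))) * \<Phi> (E' - D))"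
          if "E' \<subseteq> E - B" for E'
          using that less.prems(7) by auto
      qed (use B less.prems \<open>finite B\<close> in auto)
    qed
  qed
  finally show ?case .
qed

subsection \<open>Replica identities at imaginary field\<close>

text \<open>The formal series in theta of \<open>c * exp (i * x * theta)\<close>: a configuration of
  weight \<open>c\<close> and magnetisation \<open>x\<close> in a purely imaginary field.\<close>

definition wave :: "real \<Rightarrow> real \<Rightarrow> complex fps" where
  "wave c x = fps_const (of_real c) * fps_exp (\<i> * of_real x)"

lemma wave_mult: "wave c x * wave d y = wave (c * d) (x + y)"
  by (simp add: wave_def distrib_left fps_exp_add_mult mult_ac flip: fps_const_mult)

lemma wave_scale: "fps_const (of_real k) * wave c x = wave (k * c) x"
  by (simp add: wave_def mult.assoc flip: fps_const_mult)

lemma wave_zero [simp]: "wave 0 x = 0"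
  by (simp add: wave_def)

lemma wave_diff: "wave c x - wave d x = wave (c - d) x"
  by (simp add: wave_def left_diff_distrib flip: fps_const_sub)

lemma wave_minus: "wave (- c) x = - wave c x"
  by (simp add: wave_def flip: fps_const_neg)

lemma wave_nth_0: "fps_nth (wave c x) 0 = of_real c"
  by (simp add: wave_def)

lemma fps_deriv_wave: "fps_deriv (wave c x) = fps_const (\<i> * of_real x) * wave c x"
  by (simp add: wave_def mult_ac)

text \<open>The unnormalised expectation of the observable \<open>c\<close> in the field i theta;
  for \<open>c = 1\<close> it is the partition function.\<close>

definition bracket ::
  "('a \<Rightarrow> real) \<Rightarrow> ('a \<Rightarrow> 'a \<Rightarrow> real) \<Rightarrow> 'a set \<Rightarrow> ('a set \<Rightarrow> real) \<Rightarrow> complex fps" where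
  "bracket lam j W c = (\<Sum>A\<in>Pow W. wave (c A * exp (energy j W A)) (field_energy lam W A))"

text \<open>What two replicas that agree on \<open>W\<close> contribute: coupling and field are both
  doubled.\<close>

definition doubled_bracket ::
  "('a \<Rightarrow> real) \<Rightarrow> ('a \<Rightarrow> 'a \<Rightarrow> real) \<Rightarrow> 'a set \<Rightarrow> ('a set \<Rightarrow> real) \<Rightarrow> complex fps" where
  "doubled_bracket lam j W c =
    (\<Sum>A\<in>Pow W. wave (c A * exp (2 * energy j W A)) (2 * field_energy lam W A))"

text \<open>The second replica is the first one with the spins in \<open>D\<close> reversed.\<close>

definition replica_term :: "('a \<Rightarrow> real) \<Rightarrow> ('a \<Rightarrow> 'a \<Rightarrow> real) \<Rightarrow> 'a set \<Rightarrow> ('a set \<Rightarrow> real)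
    \<Rightarrow> 'a set \<Rightarrow> complex fps" where
  "replica_term lam j W c D = (\<Sum>A\<in>Pow W.
     wave (c A * (exp (2 * energy j D A) * exp (2 * energy j (W - D) A)))
       (2 * field_energy lam (W - D) A))"

text \<open>The second replica is reindexed by its difference \<open>D\<close> from the first; for
  fixed \<open>D\<close> the total energy and field follow from \<open>energy_replica\<close> and
  \<open>field_energy_replica\<close>.\<close>

lemma bracket_mult:
  assumes "finite W"
  shows "bracket lam j W c * bracket lam j W d =
    (\<Sum>D\<in>Pow W. replica_term lam j W (\<lambda>A. c A * d (sym_diff A D)) D)"
proof -
  have "bracket lam j W c * bracket lam j W d = (\<Sum>A\<in>Pow W. \<Sum>B\<in>Pow W.
     wave (c A * d B * exp (energy j W A + energy j W B)) (field_energy lam W A + field_energy lam W B))"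
    by (simp add: bracket_def sum_product wave_mult exp_add mult_ac)
  also have "\<dots> = (\<Sum>A\<in>Pow W. \<Sum>D\<in>Pow W.
     wave (c A * d (sym_diff A D) * exp (energy j W A + energy j W (sym_diff A D)))
       (field_energy lam W A + field_energy lam W (sym_diff A D)))"
    by (intro sum.cong refl sum_Pow_sym_diff [symmetric]) auto
  also have "\<dots> = (\<Sum>A\<in>Pow W. \<Sum>D\<in>Pow W.
     wave (c A * d (sym_diff A D) * (exp (2 * energy j D A) * exp (2 * energy j (W - D) A)))
       (2 * field_energy lam (W - D) A))"
  proof (intro sum.cong refl)
    fix A D assume "D \<in> Pow W"
    then have "D \<subseteq> W" by simp
    show "wave (c A * d (sym_diff A D) * exp (energy j W A + energy j W (sym_diff A D)))
       (field_energy lam W A + field_energy lam W (sym_diff A D)) =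
       wave (c A * d (sym_diff A D) * (exp (2 * energy j D A) * exp (2 * energy j (W - D) A)))
       (2 * field_energy lam (W - D) A)"
      unfolding energy_replica [OF assms \<open>D \<subseteq> W\<close>] field_energy_replica [OF assms \<open>D \<subseteq> W\<close>]
      by (simp add: exp_add)
  qed
  also have "\<dots> = (\<Sum>D\<in>Pow W. replica_term lam j W (\<lambda>A. c A * d (sym_diff A D)) D)"
    unfolding replica_term_def by (rule sum.swap)
  finally show ?thesis .
qed

text \<open>For fixed \<open>D\<close> no interaction is left between \<open>D\<close> and its
  complement, and no field acts on \<open>D\<close>. So the sum over spins in \<open>D\<close> is a
  mere constant.\<close>

lemma replica_term_factor:
  assumes "D \<subseteq> W"
    and c: "\<And>A. c A = a (A \<inter> D) * b (A \<inter> (W - D))"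
  shows "replica_term lam j W c D
    = fps_const (of_real (free_sum j D a)) * doubled_bracket lam j (W - D) b"
proof -
  have W: "W = D \<union> (W - D)" using assms(1) by auto
  have "replica_term lam j W c D = (\<Sum>B\<in>Pow D. \<Sum>C\<in>Pow (W - D).
     wave (c (B \<union> C) * (exp (2 * energy j D (B \<union> C)) * exp (2 * energy j (W - D) (B \<union> C))))
       (2 * field_energy lam (W - D) (B \<union> C)))"
    unfolding replica_term_def by (subst W, subst sum_Pow_Un) auto
  also have "\<dots> = (\<Sum>B\<in>Pow D. \<Sum>C\<in>Pow (W - D).
     fps_const (of_real (a B * exp (2 * energy j D B))) *
       wave (b C * exp (2 * energy j (W - D) C)) (2 * field_energy lam (W - D) C))"
  proof (intro sum.cong refl)
    fix B C assume "B \<in> Pow D" "C \<in> Pow (W - D)"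
    then have BC: "(B \<union> C) \<inter> D = B" "(B \<union> C) \<inter> (W - D) = C" "B \<inter> D = B" "C \<inter> (W - D) = C" by auto
    have "energy j D (B \<union> C) = energy j D B" "energy j (W - D) (B \<union> C) = energy j (W - D) C"
      "field_energy lam (W - D) (B \<union> C) = field_energy lam (W - D) C"
      using BC by (auto intro!: energy_cong field_energy_cong)
    then show "wave (c (B \<union> C) * (exp (2 * energy j D (B \<union> C)) * exp (2 * energy j (W - D) (B \<union> C))))
       (2 * field_energy lam (W - D) (B \<union> C)) = fps_const (of_real (a B * exp (2 * energy j D B))) *
       wave (b C * exp (2 * energy j (W - D) C)) (2 * field_energy lam (W - D) C)"
      unfolding c BC wave_scale by (simp add: mult_ac)
  qed
  also have "\<dots> = fps_const (of_real (free_sum j D a)) * doubled_bracket lam j (W - D) b"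
    by (simp add: free_sum_def doubled_bracket_def fps_const_sum sum_product)
  finally show ?thesis .
qed

text \<open>Flipping all spins of \<open>D\<close> preserves the zero-field weight and changes the
  sign of \<open>c\<close>.\<close>

lemma free_sum_odd:
  assumes "\<And>A. A \<subseteq> D \<Longrightarrow> c (D - A) = - c A"
  shows "free_sum j D c = 0"
proof -
  have spin: "spin (D - A) x = - spin A x" if "x \<in> D" for A x
    using that by (auto simp: spin_def)
  have "energy j D (D - A) = energy j D A" for A
    unfolding energy_def by (intro sum.cong refl) (simp add: spin)
  then have "free_sum j D c = (\<Sum>A\<in>Pow D. - (c A * exp (2 * energy j D A)))"
    unfolding free_sum_def using assms
    by (intro sum.reindex_bij_witness [where i = "\<lambda>A. D - A" and j = "\<lambda>A. D - A"]) (auto simp: double_diff)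
  then show ?thesis by (simp add: sum_negf free_sum_def)
qed

text \<open>Identifies the generators in \<open>layered_sum_in_cone\<close> as squares of partition
  functions.\<close>

lemma bracket_one_square:
  assumes "finite W"
  shows "bracket lam j W (\<lambda>_. 1) * bracket lam j W (\<lambda>_. 1) =
    (\<Sum>D\<in>Pow W. fps_const (of_real (free_sum j D (\<lambda>_. 1))) * doubled_bracket lam j (W - D) (\<lambda>_. 1))"
  unfolding bracket_mult [OF assms]
  by (intro sum.cong refl replica_term_factor) auto

text \<open>If \<open>v\<close> lies in \<open>D\<close>, the factor on \<open>D\<close> is odd and
  vanishes. The right side is again a generator of the exploration, with value 0 where
  \<open>v\<close> is missing.\<close>

lemma bracket_spin_one:
  assumes "finite W" "v \<in> W"
  shows "bracket lam j W (\<lambda>A. spin A v) * bracket lam j W (\<lambda>_. 1) =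
    (\<Sum>D\<in>Pow W. fps_const (of_real (free_sum j D (\<lambda>_. 1))) *
      (if v \<in> W - D then doubled_bracket lam j (W - D) (\<lambda>A. spin A v) else 0))"
  unfolding bracket_mult [OF assms(1)]
proof (intro sum.cong refl)
  fix D assume D: "D \<in> Pow W"
  show "replica_term lam j W (\<lambda>A. spin A v * 1) D = fps_const (of_real (free_sum j D (\<lambda>_. 1))) *
      (if v \<in> W - D then doubled_bracket lam j (W - D) (\<lambda>A. spin A v) else 0)"
  proof (cases "v \<in> D")
    case False
    then show ?thesis
      using D assms(2) by (subst replica_term_factor [where a = "\<lambda>_. 1" and b = "\<lambda>A. spin A v"])
        (auto simp: spin_def)
  next
    case True
    have "free_sum j D (\<lambda>A. spin A v) = 0"
      using True by (intro free_sum_odd) (auto simp: spin_def)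
    then show ?thesis
      using True D by (subst replica_term_factor [where a = "\<lambda>A. spin A v" and b = "\<lambda>_. 1"])
        (auto simp: spin_def)
  qed
qed

text \<open>The spin at \<open>w\<close> has the same sign in both replicas when \<open>w\<close> is
  outside \<open>D\<close>, so the two products cancel; for \<open>w\<close> in \<open>D\<close> the
  signs are opposite and they add up.\<close>

lemma bracket_truncated:
  assumes "finite W"
  shows "bracket lam j W (\<lambda>A. c A * spin A w) * bracket lam j W (\<lambda>_. 1)
      - bracket lam j W c * bracket lam j W (\<lambda>A. spin A w)
    = (\<Sum>D\<in>Pow W. if w \<in> D then 2 * replica_term lam j W (\<lambda>A. c A * spin A w) D else 0)"
proof -
  have "replica_term lam j W (\<lambda>A. c A * spin A w * 1) D
      - replica_term lam j W (\<lambda>A. c A * spin (sym_diff A D) w) D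
    = (if w \<in> D then 2 * replica_term lam j W (\<lambda>A. c A * spin A w) D else 0)" for D
  proof (cases "w \<in> D")
    case True
    then have "spin (sym_diff A D) w = - spin A w" for A
      by (simp add: spin_sym_diff spin_def)
    with True show ?thesis
      by (simp add: replica_term_def wave_minus sum_negf)
  next
    case False
    then have "spin (sym_diff A D) w = spin A w" for A
      by (simp add: spin_sym_diff spin_def)
    with False show ?thesis
      by (simp add: replica_term_def)
  qed
  then show ?thesis
    unfolding bracket_mult [OF assms] by (simp flip: sum_subtractf)
qed

text \<open>By parity, \<open>D\<close> must contain \<open>u\<close> together with
  \<open>w\<close>.\<close>

lemma bracket_pair_truncated:
  assumes "finite W" "u \<in> W" "w \<in> W"
  shows "bracket lam j W (\<lambda>A. spin A u * spin A w) * bracket lam j W (\<lambda>_. 1)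
      - bracket lam j W (\<lambda>A. spin A u) * bracket lam j W (\<lambda>A. spin A w)
    = 2 * (\<Sum>D\<in>Pow W. if u \<in> D \<and> w \<in> D then
        fps_const (of_real (free_sum j D (\<lambda>A. spin A u * spin A w)))
          * doubled_bracket lam j (W - D) (\<lambda>_. 1) else 0)"
  unfolding bracket_truncated [OF assms(1)] sum_distrib_left
proof (intro sum.cong refl)
  fix D assume D: "D \<in> Pow W"
  consider "w \<notin> D" | "w \<in> D" "u \<in> D" | "w \<in> D" "u \<notin> D" by blast
  then show "(if w \<in> D then 2 * replica_term lam j W (\<lambda>A. spin A u * spin A w) D else 0)
    = 2 * (if u \<in> D \<and> w \<in> D then
        fps_const (of_real (free_sum j D (\<lambda>A. spin A u * spin A w)))
          * doubled_bracket lam j (W - D) (\<lambda>_. 1) else 0)"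
  proof cases
    case 2
    then show ?thesis
      using D by (subst replica_term_factor [where a = "\<lambda>A. spin A u * spin A w" and b = "\<lambda>_. 1"])
        (auto simp: spin_def)
  next
    case 3
    have "free_sum j D (\<lambda>A. spin A w) = 0"
      using 3 by (intro free_sum_odd) (auto simp: spin_def)
    then show ?thesis
      using 3 D assms
      by (subst replica_term_factor [where a = "\<lambda>A. spin A w" and b = "\<lambda>A. spin A u"])
        (auto simp: spin_def)
  qed simp
qed

text \<open>Besides \<open>w\<close>, parity forces \<open>D\<close> to contain exactly one of
  \<open>u\<close> and \<open>v\<close>, which gives the two sums.\<close>

lemma bracket_triple_truncated:
  assumes "finite W" "u \<in> W" "v \<in> W" "w \<in> W"
  shows "bracket lam j W (\<lambda>A. spin A u * spin A v * spin A w) * bracket lam j W (\<lambda>_. 1)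
      - bracket lam j W (\<lambda>A. spin A u * spin A v) * bracket lam j W (\<lambda>A. spin A w)
    = 2 * ((\<Sum>D\<in>Pow W. if u \<in> D \<and> w \<in> D then
          fps_const (of_real (free_sum j D (\<lambda>A. spin A u * spin A w))) *
          (if v \<in> W - D then doubled_bracket lam j (W - D) (\<lambda>A. spin A v) else 0) else 0)
        + (\<Sum>D\<in>Pow W. if v \<in> D \<and> w \<in> D then
          fps_const (of_real (free_sum j D (\<lambda>A. spin A v * spin A w))) *
          (if u \<in> W - D then doubled_bracket lam j (W - D) (\<lambda>A. spin A u) else 0) else 0))"
  unfolding bracket_truncated [OF assms(1)] sum.distrib [symmetric] sum_distrib_left
proof (intro sum.cong refl)
  fix D assume D: "D \<in> Pow W"
  let ?X = "\<lambda>u v. if u \<in> D \<and> w \<in> D then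
          fps_const (of_real (free_sum j D (\<lambda>A. spin A u * spin A w))) *
          (if v \<in> W - D then doubled_bracket lam j (W - D) (\<lambda>A. spin A v) else 0) else 0"
  consider "w \<notin> D" | "w \<in> D" "u \<in> D" "v \<in> D" | "w \<in> D" "u \<in> D" "v \<notin> D"
    | "w \<in> D" "u \<notin> D" "v \<in> D" | "w \<in> D" "u \<notin> D" "v \<notin> D" by blast
  then show "(if w \<in> D then 2 * replica_term lam j W (\<lambda>A. spin A u * spin A v * spin A w) D else 0)
    = 2 * (?X u v + ?X v u)"
  proof cases
    case 2
    have "free_sum j D (\<lambda>A. spin A u * spin A v * spin A w) = 0"
      using 2 by (intro free_sum_odd) (auto simp: spin_def)
    then show ?thesis
      using 2 D by (subst replica_term_factor [where a = "\<lambda>A. spin A u * spin A v * spin A w" and b = "\<lambda>_. 1"])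
        (auto simp: spin_def)
  next
    case 3
    then show ?thesis
      using D assms(3)
      by (subst replica_term_factor [where a = "\<lambda>A. spin A u * spin A w" and b = "\<lambda>A. spin A v"])
        (auto simp: spin_def)
  next
    case 4
    then show ?thesis
      using D assms(2)
      by (subst replica_term_factor [where a = "\<lambda>A. spin A v * spin A w" and b = "\<lambda>A. spin A u"])
        (auto simp: spin_def)
  next
    case 5
    have "free_sum j D (\<lambda>A. spin A w) = 0"
      using 5 by (intro free_sum_odd) (auto simp: spin_def)
    then show ?thesis
      using 5 D assms
      by (subst replica_term_factor [where a = "\<lambda>A. spin A w" and b = "\<lambda>A. spin A u * spin A v"])
        (auto simp: spin_def)
  qed simp
qed

text \<open>The exploration is started at the marked vertices: they form both the explored region
  and its last layer, and their spin product is a character, so the initial weight is of positive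
  type.\<close>

lemma free_sum_pair_in_cone:
  assumes "fps_cone C" "\<And>x y. 0 \<le> j x y" "finite W" "u \<in> W" "w \<in> W"
    and gen: "\<And>W'. W' \<subseteq> W \<Longrightarrow> C (\<Sum>D\<in>Pow W'. fps_const (of_real (free_sum j D (\<lambda>_. 1))) * \<Phi> (W' - D))"
  shows "C (\<Sum>D\<in>Pow W. if u \<in> D \<and> w \<in> D then
    fps_const (of_real (free_sum j D (\<lambda>A. spin A u * spin A w))) * \<Phi> (W - D) else 0)"
proof -
  define S where "S = {u, w}"
  define g where "g A = spin A u * spin A w * exp (2 * energy j S A)" for A
  have "(\<Sum>D\<in>Pow W. if u \<in> D \<and> w \<in> D then
      fps_const (of_real (free_sum j D (\<lambda>A. spin A u * spin A w))) * \<Phi> (W - D) else 0)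
    = (\<Sum>D\<in>{D\<in>Pow W. S \<subseteq> D}.
      fps_const (of_real (free_sum j D (\<lambda>A. spin A u * spin A w))) * \<Phi> (W - D))"
    using assms(3) by (subst sum.inter_filter) (auto simp: S_def intro!: sum.cong)
  also have "\<dots> = (\<Sum>D\<in>Pow (W - S). fps_const (of_real (layered_sum j S S g D)) * \<Phi> (W - S - D))"
  proof (intro sum.reindex_bij_witness [where i = "\<lambda>D. S \<union> D" and j = "\<lambda>D. D - S"])
    fix D assume D: "D \<in> {D \<in> Pow W. S \<subseteq> D}"
    have fin: "finite S" "finite (D - S)" using D assms(3) by (auto simp: S_def intro: finite_subset)
    have SD: "S \<union> (D - S) = D" "S \<union> D = D" using D by auto
    have "energy j D A = energy j S A + cross_energy j S (D - S) A + energy j (D - S) A" for A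
      using energy_Un [OF fin] SD by (metis Diff_disjoint)
    then have "layered_sum j S S g (D - S) = free_sum j D (\<lambda>A. spin A u * spin A w)"
      by (simp add: layered_sum_def free_sum_def g_def SD exp_add mult.assoc distrib_left)
    moreover have "W - S - (D - S) = W - D" using D by auto
    ultimately show "fps_const (of_real (layered_sum j S S g (D - S))) * \<Phi> (W - S - (D - S)) =
      fps_const (of_real (free_sum j D (\<lambda>A. spin A u * spin A w))) * \<Phi> (W - D)" by simp
  qed (use assms(4,5) in \<open>auto simp: S_def\<close>)
  also have "C \<dots>"
  proof (rule layered_sum_in_cone [OF assms(1,2)])
    show "positive_type g"
      unfolding g_def using assms(2)
      by (intro positive_type_mult positive_type_spin_spin positive_type_exp_energy) (auto simp: S_def)
    show "g A = g (A \<inter> S)" for A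
      unfolding g_def by (subst energy_cong [of A S "A \<inter> S"]) (auto simp: spin_def S_def)
    show "C (\<Sum>D\<in>Pow E'. fps_const (of_real (free_sum j D (\<lambda>_. 1))) * \<Phi> (E' - D))"
      if "E' \<subseteq> W - S" for E'
      using that gen by auto
  qed (use assms(3) in \<open>auto simp: S_def\<close>)
  finally show ?thesis .
qed

subsection \<open>Coefficient signs\<close>

text \<open>Membership in the nonnegative reals also asserts that the complex coefficients are
  real.\<close>

definition nonneg_upto :: "nat \<Rightarrow> complex fps \<Rightarrow> bool" where
  "nonneg_upto d F \<longleftrightarrow> (\<forall>n\<le>d. fps_nth F n \<in> \<real>\<^sub>\<ge>\<^sub>0)"

lemma nonneg_Reals_sum: "(\<And>i. i \<in> I \<Longrightarrow> f i \<in> \<real>\<^sub>\<ge>\<^sub>0) \<Longrightarrow> (\<Sum>i\<in>I. f i) \<in> (\<real>\<^sub>\<ge>\<^sub>0 :: complex set)"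
  by (induction I rule: infinite_finite_induct) auto

lemma nonneg_upto_0 [simp]: "nonneg_upto d 0"
  by (simp add: nonneg_upto_def)

lemma nonneg_upto_add: "nonneg_upto d F \<Longrightarrow> nonneg_upto d G \<Longrightarrow> nonneg_upto d (F + G)"
  by (simp add: nonneg_upto_def)

lemma nonneg_upto_sum: "(\<And>i. i \<in> I \<Longrightarrow> nonneg_upto d (F i)) \<Longrightarrow> nonneg_upto d (\<Sum>i\<in>I. F i)"
  by (induction I rule: infinite_finite_induct) (auto intro: nonneg_upto_add)

lemma nonneg_upto_mult: "nonneg_upto d F \<Longrightarrow> nonneg_upto d G \<Longrightarrow> nonneg_upto d (F * G)"
  by (auto simp: nonneg_upto_def fps_mult_nth intro!: nonneg_Reals_sum nonneg_Reals_mult_I)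

lemma nonneg_upto_const: "0 \<le> r \<Longrightarrow> nonneg_upto d (fps_const (of_real r))"
  by (auto simp: nonneg_upto_def)

text \<open>Integration gains one degree; this drives the induction.\<close>

lemma nonneg_upto_SucI:
  assumes "fps_nth F 0 \<in> \<real>\<^sub>\<ge>\<^sub>0" "nonneg_upto d (fps_deriv F)"
  shows "nonneg_upto (Suc d) F"
  unfolding nonneg_upto_def
proof (intro allI impI)
  fix n assume n: "n \<le> Suc d"
  show "fps_nth F n \<in> \<real>\<^sub>\<ge>\<^sub>0"
  proof (cases n)
    case (Suc m)
    then have "of_nat (Suc m) * fps_nth F (Suc m) \<in> \<real>\<^sub>\<ge>\<^sub>0"
      using assms(2) n by (simp add: nonneg_upto_def)
    then have "of_nat (Suc m) * fps_nth F (Suc m) / of_nat (Suc m) \<in> \<real>\<^sub>\<ge>\<^sub>0"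
      by (intro nonneg_Reals_divide_I nonneg_Reals_of_nat_I)
    then show ?thesis
      unfolding Suc by (simp del: of_nat_Suc)
  qed (use assms(1) in simp)
qed

section \<open>Normalised expectations and their derivatives\<close>

abbreviation partition_fps :: "('a \<Rightarrow> real) \<Rightarrow> ('a \<Rightarrow> 'a \<Rightarrow> real) \<Rightarrow> 'a set \<Rightarrow> complex fps" where
  "partition_fps lam j W \<equiv> bracket lam j W (\<lambda>_. 1)"

lemma bracket_nth_0:
  "fps_nth (bracket lam j W c) 0 = of_real (\<Sum>A\<in>Pow W. c A * exp (energy j W A))"
  by (simp add: bracket_def fps_sum_nth wave_nth_0)

lemma sum_exp_energy_pos: "finite W \<Longrightarrow> 0 < (\<Sum>A\<in>Pow W. 1 * exp (energy j W A))"
  by (intro sum_pos) auto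

lemma partition_fps_nth_0_nonzero: "finite W \<Longrightarrow> fps_nth (partition_fps lam j W) 0 \<noteq> 0"
  unfolding bracket_nth_0 of_real_eq_0_iff
  using sum_exp_energy_pos [of W j] by linarith

lemma partition_fps_inverse [simp]:
  "finite W \<Longrightarrow> inverse (partition_fps lam j W) * partition_fps lam j W = 1"
  "finite W \<Longrightarrow> partition_fps lam j W * inverse (partition_fps lam j W) = 1"
  by (simp_all add: partition_fps_nth_0_nonzero inverse_mult_eq_1 inverse_mult_eq_1')

lemma bracket_quotient_nth_0:
  "fps_nth (bracket lam j W c * inverse (partition_fps lam j' W')) 0 =
    of_real ((\<Sum>A\<in>Pow W. c A * exp (energy j W A)) / (\<Sum>A\<in>Pow W'. 1 * exp (energy j' W' A)))"
  by (simp only: fps_mult_nth_0 fps_inverse_nth_0 bracket_nth_0 of_real_divide divide_inverse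
      of_real_mult of_real_inverse)

lemma fps_deriv_bracket:
  "fps_deriv (bracket lam j W c) =
    (\<Sum>w\<in>W. fps_const (\<i> * of_real (lam w)) * bracket lam j W (\<lambda>A. c A * spin A w))"
proof -
  have "fps_deriv (bracket lam j W c) = (\<Sum>A\<in>Pow W. \<Sum>w\<in>W.
      fps_const (\<i> * of_real (lam w)) * wave (c A * spin A w * exp (energy j W A)) (field_energy lam W A))"
  proof -
    have "fps_const (\<i> * of_real (field_energy lam W A)) * wave (c A * exp (energy j W A)) (field_energy lam W A)
      = (\<Sum>w\<in>W. fps_const (\<i> * of_real (lam w)) * wave (c A * spin A w * exp (energy j W A)) (field_energy lam W A))" for A
    proof -
      have "wave (c A * spin A w * exp (energy j W A)) (field_energy lam W A) =
        fps_const (of_real (spin A w)) * wave (c A * exp (energy j W A)) (field_energy lam W A)" for w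
        unfolding wave_scale by (simp add: mult_ac)
      then show ?thesis
        unfolding field_energy_def
        by (simp add: sum_distrib_left sum_distrib_right fps_const_sum mult.assoc flip: fps_const_mult)
    qed
    then show ?thesis
      by (simp only: bracket_def fps_deriv_wave fps_deriv_sum)
  qed
  also have "\<dots> = (\<Sum>w\<in>W. fps_const (\<i> * of_real (lam w)) * bracket lam j W (\<lambda>A. c A * spin A w))"
    by (subst sum.swap) (simp add: bracket_def sum_distrib_left)
  finally show ?thesis .
qed

text \<open>The quotient rule, kept over the squared partition function so that the numerators are
  the truncated products of the replica identities.\<close>

lemma fps_deriv_bracket_quotient:
  assumes "finite W"
  shows "fps_deriv (bracket lam j W c * inverse (partition_fps lam j W)) =
    (\<Sum>w\<in>W. fps_const (\<i> * of_real (lam w)) *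
      ((bracket lam j W (\<lambda>A. c A * spin A w) * partition_fps lam j W
        - bracket lam j W c * bracket lam j W (\<lambda>A. spin A w))
       * (inverse (partition_fps lam j W))\<^sup>2))"
proof -
  let ?f = "partition_fps lam j W"
  let ?g = "inverse ?f"
  have gf: "?f * ?g\<^sup>2 = ?g"
    using assms by (simp add: power2_eq_square flip: mult.assoc)
  have "fps_deriv (bracket lam j W c * ?g) = fps_deriv (bracket lam j W c) * ?f * ?g\<^sup>2
      - bracket lam j W c * fps_deriv ?f * ?g\<^sup>2"
    using assms
    by (simp add: fps_inverse_deriv partition_fps_nth_0_nonzero gf mult.assoc)
  also have "\<dots> = (\<Sum>w\<in>W. fps_const (\<i> * of_real (lam w)) *
      ((bracket lam j W (\<lambda>A. c A * spin A w) * ?f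
        - bracket lam j W c * bracket lam j W (\<lambda>A. spin A w)) * ?g\<^sup>2))"
    unfolding fps_deriv_bracket
    by (simp add: sum_distrib_left sum_distrib_right sum_subtractf algebra_simps)
  finally show ?thesis .
qed

lemma fps_deriv_inverse_partition:
  assumes "finite W"
  shows "fps_deriv (inverse (partition_fps lam j W)) =
    (\<Sum>w\<in>W. fps_const (of_real (lam w)) *
      (fps_const (- \<i>) * (bracket lam j W (\<lambda>A. spin A w) * inverse (partition_fps lam j W)))
      * inverse (partition_fps lam j W))"
proof -
  let ?g = "inverse (partition_fps lam j W)"
  have i: "fps_const (\<i> * of_real c) = - (fps_const (of_real c) * fps_const (- \<i>))" for c
    by (simp add: mult.commute)
  have "fps_deriv ?g = - (fps_deriv (partition_fps lam j W) * ?g\<^sup>2)"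
    using assms by (simp add: fps_inverse_deriv partition_fps_nth_0_nonzero)
  also have "\<dots> = (\<Sum>w\<in>W. - (fps_const (\<i> * of_real (lam w)) * bracket lam j W (\<lambda>A. spin A w) * ?g\<^sup>2))"
    by (simp only: fps_deriv_bracket sum_distrib_right sum_negf mult_1_left)
  also have "\<dots> = (\<Sum>w\<in>W. fps_const (of_real (lam w)) *
      (fps_const (- \<i>) * (bracket lam j W (\<lambda>A. spin A w) * ?g)) * ?g)"
    unfolding i by (simp add: power2_eq_square mult_ac del: fps_const_mult fps_const_neg)
  finally show ?thesis .
qed

text \<open>All three statements are quantified over every interaction and every region, because the induction
  step deletes vertices.\<close>

definition coeff_signs :: "('a \<Rightarrow> real) \<Rightarrow> nat \<Rightarrow> bool" where
  "coeff_signs lam d \<longleftrightarrow> (\<forall>j W. finite W \<longrightarrow> (\<forall>x y. 0 \<le> j x y) \<longrightarrow>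
     nonneg_upto d (inverse (partition_fps lam j W)) \<and>
     (\<forall>v\<in>W. nonneg_upto d (fps_const (- \<i>) *
        (bracket lam j W (\<lambda>A. spin A v) * inverse (partition_fps lam j W)))) \<and>
     (\<forall>u\<in>W. \<forall>v\<in>W. \<exists>r::real. nonneg_upto d (fps_const (of_real r) -
        bracket lam j W (\<lambda>A. spin A u * spin A v) * inverse (partition_fps lam j W))))"

lemma coeff_signsD:
  assumes "coeff_signs lam d" "finite W" "\<And>x y. 0 \<le> j x y"
  shows coeff_signs_inverse: "nonneg_upto d (inverse (partition_fps lam j W))"
    and coeff_signs_spin: "v \<in> W \<Longrightarrow> nonneg_upto d (fps_const (- \<i>) *
        (bracket lam j W (\<lambda>A. spin A v) * inverse (partition_fps lam j W)))"
    and coeff_signs_spin_spin: "u \<in> W \<Longrightarrow> v \<in> W \<Longrightarrow> \<exists>r::real. nonneg_upto d (fps_const (of_real r) -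
        bracket lam j W (\<lambda>A. spin A u * spin A v) * inverse (partition_fps lam j W))"
  using assms unfolding coeff_signs_def by blast+

section \<open>Lowering couplings and shrinking the region\<close>

lemma energy_update:
  assumes "finite W" "u \<in> W" "v \<in> W"
  shows "energy (j(u := (j u)(v := c))) W A = energy j W A - (j u v - c) * (spin A u * spin A v)"
proof -
  have "energy j W A - energy (j(u := (j u)(v := c))) W A
      = (\<Sum>x\<in>W. \<Sum>y\<in>W. if x = u then if y = v then (j u v - c) * (spin A u * spin A v) else 0 else 0)"
    unfolding energy_def sum_subtractf [symmetric]
    by (intro sum.cong refl) (auto simp: algebra_simps)
  also have "\<dots> = (j u v - c) * (spin A u * spin A v)"
  proof -
    have "(\<Sum>y\<in>W. if x = u then if y = v then k else 0 else 0) = (if x = u then k else 0)" for x and k :: real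
      using assms by (cases "x = u") simp_all
    then show ?thesis using assms by simp
  qed
  finally show ?thesis by simp
qed

text \<open>Lowering a coupling multiplies each weight by
  \<open>exp (- k s) = cosh k - s sinh k\<close> with \<open>s = \<plusminus>1\<close>.\<close>

lemma partition_fps_update:
  assumes "finite W" "u \<in> W" "v \<in> W"
  shows "partition_fps lam (j(u := (j u)(v := c))) W =
    fps_const (of_real (cosh (j u v - c))) * partition_fps lam j W
    - fps_const (of_real (sinh (j u v - c))) * bracket lam j W (\<lambda>A. spin A u * spin A v)"
proof -
  have "exp (energy j W A - k * (spin A u * spin A v)) =
      cosh k * exp (energy j W A) - sinh k * (spin A u * spin A v * exp (energy j W A))" for A k
  proof -
    have "exp (energy j W A - k * (spin A u * spin A v)) =
        exp (energy j W A) * exp ((- k) * (spin A u * spin A v))"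
      by (simp flip: exp_add)
    then show ?thesis
      unfolding exp_mult_spin_spin by (simp add: algebra_simps)
  qed
  then show ?thesis
    using assms
    by (simp add: bracket_def sum_distrib_left wave_scale wave_diff energy_update flip: sum_subtractf)
qed

text \<open>The quotient is cosh k - sinh k times the normalised pair expectation, with k the amount
  of the lowering. As sinh k is nonnegative, all nonconstant coefficients have the sign given by
  \<open>coeff_signs_spin_spin\<close>.\<close>

lemma partition_ratio_update:
  assumes "coeff_signs lam d" "finite W" "\<And>x y. 0 \<le> j x y" "c \<le> j u v"
  shows "nonneg_upto d (partition_fps lam (j(u := (j u)(v := c))) W * inverse (partition_fps lam j W))"
proof (cases "u \<in> W \<and> v \<in> W")
  case True
  let ?k = "j u v - c" and ?f = "partition_fps lam j W"
  let ?Q = "bracket lam j W (\<lambda>A. spin A u * spin A v) * inverse ?f"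
  let ?R = "partition_fps lam (j(u := (j u)(v := c))) W * inverse ?f"
  obtain r :: real where r: "nonneg_upto d (fps_const (of_real r) - ?Q)"
    using coeff_signs_spin_spin [of lam d W j u v] assms(1-3) True by blast
  have R: "?R = fps_const (of_real (cosh ?k - sinh ?k * r))
      + fps_const (of_real (sinh ?k)) * (fps_const (of_real r) - ?Q)"
    using True assms(2)
    by (simp add: partition_fps_update left_diff_distrib right_diff_distrib mult.assoc
        flip: fps_const_mult fps_const_sub)
  show ?thesis
    unfolding nonneg_upto_def
  proof (intro allI impI)
    fix n assume n: "n \<le> d"
    show "fps_nth ?R n \<in> \<real>\<^sub>\<ge>\<^sub>0"
    proof (cases "n = 0")
      \<comment> \<open>The constant coefficient is a ratio of zero-field partition sums. The
        splitting \<open>R\<close> does not show its sign, since \<open>r\<close> is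
        unspecified.\<close>
      case True
      then show ?thesis
        unfolding True bracket_quotient_nth_0 nonneg_Reals_of_real_iff
        by (intro divide_nonneg_nonneg sum_nonneg) auto
    next
      case False
      have "nonneg_upto d (fps_const (of_real (sinh ?k)) * (fps_const (of_real r) - ?Q))"
        using assms(4) r by (intro nonneg_upto_mult [OF nonneg_upto_const]) auto
      then have "fps_nth (fps_const (of_real (sinh ?k)) * (fps_const (of_real r) - ?Q)) n \<in> \<real>\<^sub>\<ge>\<^sub>0"
        using n by (simp only: nonneg_upto_def)
      then show ?thesis
        unfolding R using False by (simp only: fps_add_nth fps_nth_fps_const if_False add_0_left)
    qed
  qed
next
  case False
  then have "energy (j(u := (j u)(v := c))) W A = energy j W A" for A
    unfolding energy_def by (intro sum.cong refl) auto
  then have "partition_fps lam (j(u := (j u)(v := c))) W = partition_fps lam j W"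
    by (simp add: bracket_def)
  then show ?thesis
    using assms(2) nonneg_upto_const [of 1] by simp
qed

text \<open>One ordered pair is lowered at a time, and the quotients telescope into a
  product.\<close>

lemma partition_ratio_antimono:
  assumes "coeff_signs lam d" "finite W" "\<And>x y. 0 \<le> j' x y" "\<And>x y. j' x y \<le> j x y"
  shows "nonneg_upto d (partition_fps lam j' W * inverse (partition_fps lam j W))"
proof -
  \<comment> \<open>\<open>h P\<close> is lowered exactly on \<open>P\<close>; it stays nonnegative,
    so the one-step lemma applies at each stage.\<close>
  define h where "h P = (\<lambda>x y. if (x, y) \<in> P then j' x y else j x y)" for P
  have h_nonneg: "0 \<le> h P x y" for P x y
    using assms(3,4) [of x y] by (simp add: h_def)
  have "nonneg_upto d (partition_fps lam (h P) W * inverse (partition_fps lam j W))"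
    if "finite P" for P
    using that
  proof (induction P rule: finite_induct)
    case empty
    have "h {} = j" by (simp add: h_def fun_eq_iff)
    then show ?case
      using assms(2) nonneg_upto_const [of 1] by simp
  next
    case (insert p P)
    obtain u v where p: "p = (u, v)" by force
    have "h (insert p P) = (h P)(u := (h P u)(v := j' u v))"
      by (auto simp: h_def p fun_eq_iff)
    moreover have "j' u v \<le> h P u v"
      using assms(4) by (simp add: h_def)
    ultimately have "nonneg_upto d (partition_fps lam (h (insert p P)) W * inverse (partition_fps lam (h P) W))"
      using partition_ratio_update [OF assms(1,2), of "h P" "j' u v" u v] h_nonneg by simp
    from nonneg_upto_mult [OF this insert.IH]
    have "nonneg_upto d (partition_fps lam (h (insert p P)) W *
        (inverse (partition_fps lam (h P) W) * partition_fps lam (h P) W) * inverse (partition_fps lam j W))"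
      by (simp only: mult.assoc)
    then show ?case using assms(2) by simp
  qed
  from this [of "W \<times> W"] have "nonneg_upto d (partition_fps lam (h (W \<times> W)) W * inverse (partition_fps lam j W))"
    using assms(2) by simp
  moreover have "energy (h (W \<times> W)) W A = energy j' W A" for A
    unfolding energy_def by (intro sum.cong refl) (simp add: h_def)
  then have "partition_fps lam (h (W \<times> W)) W = partition_fps lam j' W"
    by (simp add: bracket_def)
  ultimately show ?thesis by simp
qed

text \<open>Expresses the smaller region through a change of couplings on the fixed region
  \<open>W\<close>, at the price of a factor for free spins.\<close>

lemma partition_fps_decouple:
  assumes "finite W" "E \<subseteq> W"
  shows "partition_fps lam (\<lambda>x y. if x \<in> E \<and> y \<in> E then j x y else 0) W
    = partition_fps lam j E * partition_fps lam (\<lambda>_ _. 0) (W - E)"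
proof -
  have fin: "finite E" "finite (W - E)" and W: "E \<union> (W - E) = W"
    using assms by (auto intro: finite_subset)
  have PowW: "Pow W = Pow (E \<union> (W - E))"
    using W by simp
  have fe: "field_energy lam W A = field_energy lam E A + field_energy lam (W - E) A" for A
    using field_energy_Un [OF fin Diff_disjoint] W by simp
  have en: "energy (\<lambda>x y. if x \<in> E \<and> y \<in> E then j x y else 0) W A = energy j E A" for A
    unfolding energy_def using assms
    by (intro sum.mono_neutral_cong_right) (auto intro!: sum.mono_neutral_cong_right sum.neutral)
  have "partition_fps lam (\<lambda>x y. if x \<in> E \<and> y \<in> E then j x y else 0) W
    = (\<Sum>B\<in>Pow E. \<Sum>C\<in>Pow (W - E). wave (exp (energy j E (B \<union> C)))
        (field_energy lam E (B \<union> C) + field_energy lam (W - E) (B \<union> C)))"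
    unfolding bracket_def
    by (simp only: en fe PowW sum_Pow_Un [OF Diff_disjoint] mult_1_left)
  also have "\<dots> = (\<Sum>B\<in>Pow E. \<Sum>C\<in>Pow (W - E). wave (exp (energy j E B))
        (field_energy lam E B + field_energy lam (W - E) C))"
  proof (intro sum.cong refl)
    fix B C assume "B \<in> Pow E" "C \<in> Pow (W - E)"
    then have "energy j E (B \<union> C) = energy j E B" "field_energy lam E (B \<union> C) = field_energy lam E B"
      "field_energy lam (W - E) (B \<union> C) = field_energy lam (W - E) C"
      by (auto intro!: energy_cong field_energy_cong)
    then show "wave (exp (energy j E (B \<union> C))) (field_energy lam E (B \<union> C) + field_energy lam (W - E) (B \<union> C))
      = wave (exp (energy j E B)) (field_energy lam E B + field_energy lam (W - E) C)" by simp
  qed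
  also have "\<dots> = partition_fps lam j E * partition_fps lam (\<lambda>_ _. 0) (W - E)"
    by (simp add: bracket_def sum_product wave_mult energy_def)
  finally show ?thesis .
qed

text \<open>All couplings not inside \<open>E\<close> are lowered to zero. The factor of the free
  spins on \<open>W - E\<close> is then removed by its inverse, which also has nonnegative
  coefficients up to \<open>d\<close>.\<close>

lemma partition_ratio_subset:
  assumes "coeff_signs lam d" "finite W" "\<And>x y. 0 \<le> j x y" "E \<subseteq> W"
  shows "nonneg_upto d (partition_fps lam j E * inverse (partition_fps lam j W))"
proof -
  let ?j = "\<lambda>x y. if x \<in> E \<and> y \<in> E then j x y else 0"
  let ?p = "partition_fps lam (\<lambda>_ _. 0) (W - E)"
  have "nonneg_upto d (partition_fps lam ?j W * inverse (partition_fps lam j W))"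
    using assms by (intro partition_ratio_antimono) auto
  moreover have "nonneg_upto d (inverse ?p)"
    using assms(1,2) by (intro coeff_signs_inverse) auto
  ultimately have "nonneg_upto d (partition_fps lam ?j W * inverse (partition_fps lam j W) * inverse ?p)"
    by (rule nonneg_upto_mult)
  moreover have "partition_fps lam ?j W * inverse (partition_fps lam j W) * inverse ?p
    = partition_fps lam j E * inverse (partition_fps lam j W) * (?p * inverse ?p)"
    using assms by (simp only: partition_fps_decouple mult_ac)
  ultimately show ?thesis using assms(2) by simp
qed

section \<open>Signs of truncated correlations\<close>

lemma fps_cone_nonneg_upto: "fps_cone (\<lambda>F. nonneg_upto d (fps_const k * (F * G)))"
  unfolding fps_cone_def
proof (intro conjI allI impI)
  fix r :: real and F
  assume "0 \<le> r" "nonneg_upto d (fps_const k * (F * G))"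
  then have "nonneg_upto d (fps_const (of_real r) * (fps_const k * (F * G)))"
    by (intro nonneg_upto_mult [OF nonneg_upto_const])
  then show "nonneg_upto d (fps_const k * (fps_const (of_real r) * F * G))"
    by (simp only: mult_ac)
qed (auto simp: distrib_left distrib_right intro: nonneg_upto_add)

text \<open>Exploration from \<open>u\<close> and \<open>w\<close> reduces the claim to generators,
  which after division are squares of the quotients in
  \<open>partition_ratio_subset\<close>.\<close>

lemma nonneg_upto_pair_truncated:
  assumes H: "coeff_signs lam d" and "finite W" and j: "\<And>x y. 0 \<le> j x y" and "u \<in> W" "w \<in> W"
  shows "nonneg_upto d ((bracket lam j W (\<lambda>A. spin A u * spin A w) * partition_fps lam j W
      - bracket lam j W (\<lambda>A. spin A u) * bracket lam j W (\<lambda>A. spin A w))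
      * (inverse (partition_fps lam j W))\<^sup>2)"
proof -
  let ?G = "(inverse (partition_fps lam j W))\<^sup>2"
  have "nonneg_upto d (fps_const 2 * ((\<Sum>D\<in>Pow W. if u \<in> D \<and> w \<in> D then
        fps_const (of_real (free_sum j D (\<lambda>A. spin A u * spin A w)))
          * doubled_bracket lam j (W - D) (\<lambda>_. 1) else 0) * ?G))"
  proof (rule free_sum_pair_in_cone [OF fps_cone_nonneg_upto j \<open>finite W\<close> \<open>u \<in> W\<close> \<open>w \<in> W\<close>])
    fix W' assume "W' \<subseteq> W"
    then have "finite W'" using assms(2) finite_subset by blast
    note ratio = partition_ratio_subset [OF H assms(2) j \<open>W' \<subseteq> W\<close>]
    have "nonneg_upto d (fps_const (of_real 2) * ((partition_fps lam j W' * inverse (partition_fps lam j W))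
       * (partition_fps lam j W' * inverse (partition_fps lam j W))))"
      by (rule nonneg_upto_mult [OF nonneg_upto_const nonneg_upto_mult [OF ratio ratio]]) simp
    then show "nonneg_upto d (fps_const 2 * ((\<Sum>D\<in>Pow W'. fps_const (of_real (free_sum j D (\<lambda>_. 1)))
        * doubled_bracket lam j (W' - D) (\<lambda>_. 1)) * ?G))"
      unfolding bracket_one_square [OF \<open>finite W'\<close>, symmetric]
      by (simp add: power2_eq_square mult_ac)
  qed
  then show ?thesis
    unfolding bracket_pair_truncated [OF assms(2,4,5)]
    by (simp add: numeral_fps_const mult.assoc)
qed

text \<open>The generators are now those of \<open>bracket_spin_one\<close>; after division each is
  a spin expectation on \<open>W'\<close> times a squared quotient, both with known signs up to
  \<open>d\<close>.\<close>

lemma nonneg_upto_triple_truncated: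
  assumes H: "coeff_signs lam d" and "finite W" and j: "\<And>x y. 0 \<le> j x y"
    and "u \<in> W" "v \<in> W" "w \<in> W"
  shows "nonneg_upto d (fps_const (- \<i>) *
    ((bracket lam j W (\<lambda>A. spin A u * spin A v * spin A w) * partition_fps lam j W
      - bracket lam j W (\<lambda>A. spin A u * spin A v) * bracket lam j W (\<lambda>A. spin A w))
      * (inverse (partition_fps lam j W))\<^sup>2))"
proof -
  let ?G = "(inverse (partition_fps lam j W))\<^sup>2"
  let ?\<Phi> = "\<lambda>v D. if v \<in> D then doubled_bracket lam j D (\<lambda>A. spin A v) else 0"
  have two: "fps_const (of_real 2) * (c * (X * G) + c * (Y * G)) = c * ((2 * (X + Y)) * G)"
    for c X Y G :: "complex fps"
    by (simp add: numeral_fps_const algebra_simps)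
  have half: "nonneg_upto d (fps_const (- \<i>) * ((\<Sum>D\<in>Pow W. if u \<in> D \<and> w \<in> D then
        fps_const (of_real (free_sum j D (\<lambda>A. spin A u * spin A w))) * ?\<Phi> v (W - D) else 0) * ?G))"
    if "u \<in> W" for u v
  proof (rule free_sum_pair_in_cone [OF fps_cone_nonneg_upto j \<open>finite W\<close> that \<open>w \<in> W\<close>])
    fix W' assume "W' \<subseteq> W"
    then have fin: "finite W'" using assms(2) finite_subset by blast
    show "nonneg_upto d (fps_const (- \<i>) * ((\<Sum>D\<in>Pow W'. fps_const (of_real (free_sum j D (\<lambda>_. 1)))
        * ?\<Phi> v (W' - D)) * ?G))"
    proof (cases "v \<in> W'")
      case True
      note ratio = partition_ratio_subset [OF H assms(2) j \<open>W' \<subseteq> W\<close>]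
      let ?r = "partition_fps lam j W' * inverse (partition_fps lam j W)"
      let ?f' = "partition_fps lam j W'"
      have "nonneg_upto d ((fps_const (- \<i>) * (bracket lam j W' (\<lambda>A. spin A v)
          * inverse ?f')) * (?r * ?r))"
        by (rule nonneg_upto_mult [OF coeff_signs_spin [OF H fin j True] nonneg_upto_mult [OF ratio ratio]])
      \<comment> \<open>The inverse of \<open>?f'\<close> that normalises the spin expectation
        cancels one of the two factors \<open>?f'\<close> from the squared quotient.\<close>
      also have "(fps_const (- \<i>) * (bracket lam j W' (\<lambda>A. spin A v) * inverse ?f')) * (?r * ?r)
        = (inverse ?f' * ?f') * (fps_const (- \<i>) * (bracket lam j W' (\<lambda>A. spin A v) * ?f' * ?G))"
        by (simp only: power2_eq_square mult_ac)
      finally show ?thesis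
        unfolding bracket_spin_one [OF fin True, symmetric] using fin by simp
    next
      case False
      then have "(\<Sum>D\<in>Pow W'. fps_const (of_real (free_sum j D (\<lambda>_. 1))) * ?\<Phi> v (W' - D)) = 0"
        by (intro sum.neutral) auto
      then show ?thesis by simp
    qed
  qed
  have "nonneg_upto d (fps_const (of_real 2) * (fps_const (- \<i>) * ((\<Sum>D\<in>Pow W. if u \<in> D \<and> w \<in> D then
        fps_const (of_real (free_sum j D (\<lambda>A. spin A u * spin A w))) * ?\<Phi> v (W - D) else 0) * ?G)
     + fps_const (- \<i>) * ((\<Sum>D\<in>Pow W. if v \<in> D \<and> w \<in> D then
        fps_const (of_real (free_sum j D (\<lambda>A. spin A v * spin A w))) * ?\<Phi> u (W - D) else 0) * ?G)))"
    using half [OF \<open>u \<in> W\<close>] half [OF \<open>v \<in> W\<close>]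
    by (intro nonneg_upto_mult [OF nonneg_upto_const] nonneg_upto_add) auto
  then show ?thesis
    unfolding bracket_triple_truncated [OF assms(2,4,5,6)]
    unfolding two .
qed

section \<open>The induction on the degree\<close>

lemma bracket_spin_nth_0:
  assumes "v \<in> W"
  shows "fps_nth (bracket lam j W (\<lambda>A. spin A v)) 0 = 0"
proof -
  \<comment> \<open>Halved couplings compensate for the doubled energy in
    \<open>free_sum\<close>.\<close>
  have "free_sum (\<lambda>x y. j x y / 2) W (\<lambda>A. spin A v) = 0"
    using assms by (intro free_sum_odd) (auto simp: spin_def)
  then show ?thesis
    unfolding bracket_nth_0 by (simp add: free_sum_def energy_def sum_divide_distrib [symmetric])
qed

text \<open>Degree \<open>Suc d\<close> of each statement comes from degree \<open>d\<close> of a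
  derivative: that of the inverse is built from the spin expectations and the inverse itself, those
  of the spin and pair expectations from the pair and triple truncated correlations.\<close>

lemma coeff_signs:
  assumes lam: "\<And>x. 0 \<le> lam x"
  shows "coeff_signs lam d"
proof (induction d)
  case 0
  have "nonneg_upto 0 (inverse (partition_fps lam j W))" if "finite W" for j and W :: "'a set"
    by (simp add: nonneg_upto_def bracket_nth_0 sum_nonneg flip: of_real_sum)
  moreover have "nonneg_upto 0 (fps_const (- \<i>) *
        (bracket lam j W (\<lambda>A. spin A v) * inverse (partition_fps lam j W)))" if "v \<in> W" for j and W :: "'a set" and v
    using that by (simp add: nonneg_upto_def bracket_spin_nth_0)
  moreover have "\<exists>r::real. nonneg_upto 0 (fps_const (of_real r) -
        bracket lam j W (\<lambda>A. spin A u * spin A v) * inverse (partition_fps lam j W))" for j and W :: "'a set" and u v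
  proof -
    obtain r :: real where "of_real r = fps_nth (bracket lam j W (\<lambda>A. spin A u * spin A v)
        * inverse (partition_fps lam j W)) 0"
      by (rule that) (rule bracket_quotient_nth_0 [symmetric])
    then show ?thesis
      by (intro exI [of _ r]) (simp add: nonneg_upto_def)
  qed
  ultimately show ?case
    by (simp add: coeff_signs_def)
next
  case (Suc d)
  note H = Suc.IH
  show ?case
    unfolding coeff_signs_def
  proof (intro allI impI conjI ballI)
    fix j :: "'a \<Rightarrow> 'a \<Rightarrow> real" and W :: "'a set"
    assume W: "finite W" and "\<forall>x y. 0 \<le> j x y"
    then have j: "0 \<le> j x y" for x y by blast
    show "nonneg_upto (Suc d) (inverse (partition_fps lam j W))"
    proof (rule nonneg_upto_SucI)
      show "fps_nth (inverse (partition_fps lam j W)) 0 \<in> \<real>\<^sub>\<ge>\<^sub>0"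
        by (simp add: bracket_nth_0 sum_nonneg flip: of_real_sum)
      show "nonneg_upto d (fps_deriv (inverse (partition_fps lam j W)))"
        unfolding fps_deriv_inverse_partition [OF W]
        using W j lam
        by (intro nonneg_upto_sum nonneg_upto_mult [OF nonneg_upto_mult [OF nonneg_upto_const]]
            coeff_signs_spin [OF H] coeff_signs_inverse [OF H]) auto
    qed
    fix v assume v: "v \<in> W"
    show "nonneg_upto (Suc d) (fps_const (- \<i>) *
        (bracket lam j W (\<lambda>A. spin A v) * inverse (partition_fps lam j W)))"
    proof (rule nonneg_upto_SucI)
      show "fps_nth (fps_const (- \<i>) *
        (bracket lam j W (\<lambda>A. spin A v) * inverse (partition_fps lam j W))) 0 \<in> \<real>\<^sub>\<ge>\<^sub>0"
        using v by (simp add: bracket_spin_nth_0)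
      \<comment> \<open>The prefactor \<open>- i\<close> absorbs the \<open>i\<close> produced by
        differentiating in theta.\<close>
      have i: "fps_const (- \<i>) * (fps_const (\<i> * of_real c) * F) = fps_const (of_real c) * F" for c F
        by (simp add: mult.assoc [symmetric])
      have "nonneg_upto d (\<Sum>w\<in>W. fps_const (of_real (lam w)) *
      ((bracket lam j W (\<lambda>A. spin A v * spin A w) * partition_fps lam j W
        - bracket lam j W (\<lambda>A. spin A v) * bracket lam j W (\<lambda>A. spin A w))
       * (inverse (partition_fps lam j W))\<^sup>2))"
        using nonneg_upto_pair_truncated [OF H W j v] lam
        by (intro nonneg_upto_sum nonneg_upto_mult [OF nonneg_upto_const]) auto
      then show "nonneg_upto d (fps_deriv (fps_const (- \<i>) *
        (bracket lam j W (\<lambda>A. spin A v) * inverse (partition_fps lam j W))))"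
        unfolding fps_deriv_mult_const_left fps_deriv_bracket_quotient [OF W] sum_distrib_left i .
    qed
  next
    fix j :: "'a \<Rightarrow> 'a \<Rightarrow> real" and W :: "'a set" and u v
    assume W: "finite W" and "\<forall>x y. 0 \<le> j x y" and uv: "u \<in> W" "v \<in> W"
    then have j: "0 \<le> j x y" for x y by blast
    let ?Q = "bracket lam j W (\<lambda>A. spin A u * spin A v) * inverse (partition_fps lam j W)"
    \<comment> \<open>Taking \<open>r\<close> as the constant coefficient makes the difference start
      at 0, so only its derivative matters.\<close>
    obtain r :: real where r: "of_real r = fps_nth ?Q 0"
      by (rule that) (rule bracket_quotient_nth_0 [symmetric])
    have "nonneg_upto (Suc d) (fps_const (of_real r) - ?Q)"
    proof (rule nonneg_upto_SucI)
      show "fps_nth (fps_const (of_real r) - ?Q) 0 \<in> \<real>\<^sub>\<ge>\<^sub>0"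
        using r by simp
      have i: "- (fps_const (\<i> * of_real c) * F) = fps_const (of_real c) * (fps_const (- \<i>) * F)" for c F
      proof -
        have "fps_const (\<i> * of_real c) = - (fps_const (of_real c) * fps_const (- \<i>))"
          by (simp add: mult.commute)
        then show ?thesis
          by (simp only: mult_minus_left minus_minus mult.assoc)
      qed
      have "nonneg_upto d (\<Sum>w\<in>W. fps_const (of_real (lam w)) * (fps_const (- \<i>) *
      ((bracket lam j W (\<lambda>A. spin A u * spin A v * spin A w) * partition_fps lam j W
        - bracket lam j W (\<lambda>A. spin A u * spin A v) * bracket lam j W (\<lambda>A. spin A w))
       * (inverse (partition_fps lam j W))\<^sup>2)))"
        using nonneg_upto_triple_truncated [OF H W j uv] lam
        by (intro nonneg_upto_sum nonneg_upto_mult [OF nonneg_upto_const]) auto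
      then show "nonneg_upto d (fps_deriv (fps_const (of_real r) - ?Q))"
        unfolding fps_deriv_sub fps_deriv_const fps_deriv_bracket_quotient [OF W] diff_0
          sum_negf [symmetric] i .
    qed
    then show "\<exists>r::real. nonneg_upto (Suc d) (fps_const (of_real r) - ?Q)" ..
  qed
qed

subsection \<open>Zeros of the partition function\<close>

lemma fps_conv_radius_wave: "fps_conv_radius (wave c x) = \<infinity>"
proof -
  have "min (fps_conv_radius (fps_const (of_real c :: complex))) (fps_conv_radius (fps_exp (\<i> * of_real x)))
    \<le> fps_conv_radius (wave c x)"
    unfolding wave_def by (rule fps_conv_radius_mult)
  then show ?thesis by simp
qed

lemma eval_fps_wave: "eval_fps (wave c x) z = of_real c * exp (\<i> * of_real x * z)"
  unfolding wave_def by (subst eval_fps_mult) simp_all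

lemma eval_fps_bracket:
  "fps_conv_radius (bracket lam j W c) = \<infinity>"
  "eval_fps (bracket lam j W c) z =
    (\<Sum>A\<in>Pow W. of_real (c A * exp (energy j W A)) * exp (\<i> * of_real (field_energy lam W A) * z))"
proof -
  have *: "fps_conv_radius (\<Sum>A\<in>I. wave (f A) (g A)) = \<infinity> \<and>
    eval_fps (\<Sum>A\<in>I. wave (f A) (g A)) z = (\<Sum>A\<in>I. of_real (f A) * exp (\<i> * of_real (g A) * z))"
    for I :: "'a set set" and f g
  proof (induction I rule: infinite_finite_induct)
    case (insert A I)
    have "min (fps_conv_radius (wave (f A) (g A))) (fps_conv_radius (\<Sum>A\<in>I. wave (f A) (g A)))
        \<le> fps_conv_radius (wave (f A) (g A) + (\<Sum>A\<in>I. wave (f A) (g A)))"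
      by (rule fps_conv_radius_add)
    with insert show ?case
      by (simp add: fps_conv_radius_wave eval_fps_add eval_fps_wave)
  qed simp_all
  show "fps_conv_radius (bracket lam j W c) = \<infinity>"
    unfolding bracket_def by (rule conjunct1 [OF *])
  show "eval_fps (bracket lam j W c) z =
    (\<Sum>A\<in>Pow W. of_real (c A * exp (energy j W A)) * exp (\<i> * of_real (field_energy lam W A) * z))"
    unfolding bracket_def by (rule conjunct2 [OF *])
qed

section \<open>Comparing radii of convergence\<close>

lemma fps_conv_radius_mono:
  fixes F G :: "complex fps"
  assumes "\<And>n. norm (fps_nth G n) \<le> norm (fps_nth F n)"
  shows "fps_conv_radius F \<le> fps_conv_radius G"
  unfolding fps_conv_radius_def
proof (rule conv_radius_geI_ex')
  fix r :: real assume "0 < r" "ereal r < conv_radius (fps_nth F)"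
  then have "summable (\<lambda>n. norm (fps_nth F n * of_real r ^ n))"
    by (intro abs_summable_in_conv_radius) simp
  then show "summable (\<lambda>n. fps_nth G n * of_real r ^ n)"
    by (rule summable_comparison_test') (auto simp: norm_mult intro: mult_right_mono assms)
qed

lemma norm_add_nonneg_Reals:
  fixes a b :: complex
  assumes "a \<in> \<real>\<^sub>\<ge>\<^sub>0" "b \<in> \<real>\<^sub>\<ge>\<^sub>0"
  shows "norm a \<le> norm (a + b)"
  using assms nonneg_Reals_add_I [OF assms]
  by (simp add: nonneg_Reals_cmod_eq_Re complex_nonneg_Reals_iff)

lemma fps_conv_radius_inverse_partition_mono:
  assumes "\<And>x. 0 \<le> lam x" "finite W" "\<And>x y. 0 \<le> j' x y" "\<And>x y. j' x y \<le> j x y"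
  shows "fps_conv_radius (inverse (partition_fps lam j W))
    \<le> fps_conv_radius (inverse (partition_fps lam j' W))"
proof -
  let ?B = "inverse (partition_fps lam j W)" and ?B' = "inverse (partition_fps lam j' W)"
  let ?R = "partition_fps lam j' W * ?B"
  note signs = coeff_signs [OF assms(1)]
  \<comment> \<open>\<open>r\<close> is the ratio of the zero-field partition sums. Its strict
    positivity makes the scaling by \<open>r\<close> harmless for the radius.\<close>
  obtain r where r: "fps_nth ?R 0 = of_real r" "0 < r"
  proof (rule that)
    show "0 < (\<Sum>A\<in>Pow W. 1 * exp (energy j' W A)) / (\<Sum>A\<in>Pow W. 1 * exp (energy j W A))"
      by (intro divide_pos_pos sum_exp_energy_pos assms)
  qed (rule bracket_quotient_nth_0)
  have "norm (fps_nth (fps_const (of_real r) * ?B') n) \<le> norm (fps_nth ?B n)" for n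
  proof -
    \<comment> \<open>Signs up to \<open>n\<close> suffice to compare the coefficients at
      \<open>n\<close>, and \<open>n\<close> is arbitrary.\<close>
    have "nonneg_upto n ?R"
      by (intro partition_ratio_antimono signs assms)
    then have "nonneg_upto n (?R - fps_const (of_real r))"
      using r by (simp add: nonneg_upto_def)
    then have "nonneg_upto n ((?R - fps_const (of_real r)) * ?B')"
      using assms by (intro nonneg_upto_mult coeff_signs_inverse signs) auto
    moreover have "nonneg_upto n (fps_const (of_real r) * ?B')"
      using assms r(2) by (intro nonneg_upto_mult [OF nonneg_upto_const] coeff_signs_inverse signs) auto
    moreover have "?B = fps_const (of_real r) * ?B' + (?R - fps_const (of_real r)) * ?B'"
    proof -
      have "?R * ?B' = ?B * (partition_fps lam j' W * ?B')"
        by (simp only: mult_ac)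
      then show ?thesis
        using assms(2) by (simp add: left_diff_distrib)
    qed
    ultimately show ?thesis
      unfolding nonneg_upto_def by (metis norm_add_nonneg_Reals fps_add_nth order_refl)
  qed
  then have "fps_conv_radius ?B \<le> fps_conv_radius (fps_const (of_real r) * ?B')"
    by (rule fps_conv_radius_mono)
  then show ?thesis
    using r(2) by (simp add: fps_conv_radius_cmult_left)
qed

text \<open>A zero-free disc for \<open>j\<close> bounds the radius of convergence of the inverse
  from below, and the bound passes to \<open>j'\<close>. Inside that radius the inverse times the
  partition function evaluates to 1, which excludes a zero.\<close>

lemma partition_zero_free_disc_mono:
  assumes "\<And>x. 0 \<le> lam x" "finite W" "\<And>x y. 0 \<le> j' x y" "\<And>x y. j' x y \<le> j x y"
    and "\<And>z. ereal (norm z) < r \<Longrightarrow> eval_fps (partition_fps lam j W) z \<noteq> 0"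
    and "ereal (norm z) < r"
  shows "eval_fps (partition_fps lam j' W) z \<noteq> 0"
proof -
  let ?f' = "partition_fps lam j' W"
  have "r \<le> fps_conv_radius (inverse (partition_fps lam j W))"
    using fps_conv_radius_inverse [of r "partition_fps lam j W"] assms(5)
    by (simp add: eval_fps_bracket(1))
  also have "\<dots> \<le> fps_conv_radius (inverse ?f')"
    by (intro fps_conv_radius_inverse_partition_mono assms)
  finally have "ereal (norm z) < fps_conv_radius (inverse ?f')"
    using assms(6) by order
  then have "eval_fps (inverse ?f' * ?f') z = eval_fps (inverse ?f') z * eval_fps ?f' z"
    by (intro eval_fps_mult) (simp_all add: eval_fps_bracket(1))
  then show ?thesis
    using assms(2) by auto
qed

section \<open>Translation from the Ising model to the set encoding\<close>

text \<open>Energies are sums over ordered pairs, so each edge is counted twice.\<close>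

definition edge_coupling :: "'a set set \<Rightarrow> ('a set \<Rightarrow> real) \<Rightarrow> 'a \<Rightarrow> 'a \<Rightarrow> real" where
  "edge_coupling E J x y = (if {x, y} \<in> E then J {x, y} / 2 else 0)"

lemma sum_edges_eq_energy:
  assumes "simple_graph V E"
  shows "(\<Sum>e\<in>E. J e * (\<Prod>x\<in>e. restrict (spin A) V x)) = energy (edge_coupling E J) V A"
proof -
  have edge: "e \<subseteq> V" "card e = 2" if "e \<in> E" for e
    using assms that by (auto simp: simple_graph_def intro: finite_subset [of E "Pow V"])
  have finV: "finite V" "finite E"
    using assms by (auto simp: simple_graph_def intro: finite_subset [of E "Pow V"])
  let ?S = "{p \<in> V \<times> V. {fst p, snd p} \<in> E}"
  let ?h = "\<lambda>p. J {fst p, snd p} / 2 * (spin A (fst p) * spin A (snd p))"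
  have "energy (edge_coupling E J) V A = (\<Sum>p\<in>V \<times> V. if {fst p, snd p} \<in> E then ?h p else 0)"
    unfolding energy_def sum.cartesian_product
    by (intro sum.cong refl) (auto simp: edge_coupling_def)
  also have "\<dots> = sum ?h ?S"
    using finV by (intro sum.inter_filter [symmetric]) simp
  \<comment> \<open>Each fibre over an edge consists of its two orderings, whose halves add up to
    \<open>J e\<close>; diagonal pairs are absent because edges have two elements.\<close>
  also have "\<dots> = (\<Sum>e\<in>E. sum ?h {p \<in> ?S. {fst p, snd p} = e})"
    using finV by (intro sum.group [symmetric]) auto
  also have "\<dots> = (\<Sum>e\<in>E. J e * (\<Prod>x\<in>e. restrict (spin A) V x))"
  proof (intro sum.cong refl)
    fix e assume e: "e \<in> E"
    have "\<exists>a b. e = {a, b} \<and> a \<noteq> b"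
      using edge(2) [OF e] by (simp only: card_2_iff)
    then obtain a b where ab: "e = {a, b}" "a \<noteq> b"
      by blast
    have V: "a \<in> V" "b \<in> V"
      using edge(1) [OF e] ab(1) by auto
    have pairs: "{p \<in> ?S. {fst p, snd p} = e} = {(a, b), (b, a)}"
    proof (intro set_eqI iffI)
      fix p assume "p \<in> {p \<in> ?S. {fst p, snd p} = e}"
      then have "{fst p, snd p} = {a, b}" by (simp add: ab(1))
      then show "p \<in> {(a, b), (b, a)}"
        by (cases p) (simp add: doubleton_eq_iff)
    next
      fix p assume "p \<in> {(a, b), (b, a)}"
      then have "p \<in> V \<times> V" "{fst p, snd p} = e"
        using V ab(1) by auto
      then show "p \<in> {p \<in> ?S. {fst p, snd p} = e}"
        using e by simp
    qed
    have "sum ?h {p \<in> ?S. {fst p, snd p} = e} = ?h (a, b) + ?h (b, a)"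
      unfolding pairs using ab(2) by simp
    also have "\<dots> = J e * (spin A a * spin A b)"
      by (simp add: ab(1) insert_commute [of b a])
    also have "\<dots> = J e * (\<Prod>x\<in>e. restrict (spin A) V x)"
      using ab V by simp
    finally show "sum ?h {p \<in> ?S. {fst p, snd p} = e} = J e * (\<Prod>x\<in>e. restrict (spin A) V x)" .
  qed
  finally show ?thesis ..
qed

lemma sum_spin_configs:
  "(\<Sum>\<sigma>\<in>spin_configs V. F \<sigma>) = (\<Sum>A\<in>Pow V. F (restrict (spin A) V))"
proof (intro sum.reindex_bij_witness [where i = "\<lambda>A. restrict (spin A) V" and j = "\<lambda>\<sigma>. {x \<in> V. \<sigma> x = -1}"])
  fix \<sigma> assume \<sigma>: "\<sigma> \<in> spin_configs V"
  show eq: "restrict (spin {x \<in> V. \<sigma> x = -1}) V = \<sigma>"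
  proof
    fix x
    show "restrict (spin {x \<in> V. \<sigma> x = -1}) V x = \<sigma> x"
      using \<sigma> PiE_mem [of \<sigma> V "\<lambda>_. {-1, 1}" x] PiE_arb [of \<sigma> V "\<lambda>_. {-1, 1}" x]
      by (auto simp: spin_configs_def spin_def)
  qed
  then show "F (restrict (spin {x \<in> V. \<sigma> x = -1}) V) = F \<sigma>" by simp
next
  fix A assume "A \<in> Pow V"
  then show "{x \<in> V. restrict (spin A) V x = -1} = A"
    by (auto simp: spin_def split: if_splits)
  show "restrict (spin A) V \<in> spin_configs V"
    by (auto simp: spin_configs_def spin_def)
qed auto

text \<open>The field \<open>h\<close> is i theta with theta = - i \<open>h\<close>, and the
  positive normalisation does not affect zeros. Extending \<open>lam\<close> by 0 off
  \<open>V\<close> makes it nonnegative everywhere, as the sign results ask.\<close>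

lemma ising_mgf_eq_0_iff:
  assumes "simple_graph V E"
  shows "ising_mgf V E J lam h = 0 \<longleftrightarrow>
    eval_fps (partition_fps (\<lambda>u. if u \<in> V then lam u else 0) (edge_coupling E J) V) (- \<i> * h) = 0"
proof -
  have "finite V" using assms by (simp add: simple_graph_def)
  have weight: "ising_weight E J (restrict (spin A) V) = exp (energy (edge_coupling E J) V A)" for A
    unfolding ising_weight_def sum_edges_eq_energy [OF assms] ..
  have field: "(\<Sum>u\<in>V. lam u * spin A u)
      = field_energy (\<lambda>u. if u \<in> V then lam u else 0) V A" for A
    unfolding field_energy_def by (intro sum.cong) auto
  have "ising_Z V E J > 0"
    using sum_exp_energy_pos [OF \<open>finite V\<close>, of "edge_coupling E J"]
    by (simp add: ising_Z_def sum_spin_configs weight)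
  then show ?thesis
    by (simp add: ising_mgf_def sum_spin_configs weight field eval_fps_bracket mult_ac del: of_real_sum)
qed

theorem mainTheorem2:
  fixes V :: "'a set" and E :: "'a set set"
    and J Jt :: "'a set \<Rightarrow> real" and lam :: "'a \<Rightarrow> real"
  assumes "simple_graph V E"
    and "\<And>e. e \<in> E \<Longrightarrow> 0 \<le> J e"
    and "\<And>e. e \<in> E \<Longrightarrow> J e \<le> Jt e"
    and "\<And>u. u \<in> V \<Longrightarrow> 0 \<le> lam u"
  shows "alpha1 V E J lam \<ge> alpha1 V E Jt lam"
  unfolding alpha1_def [of V E J lam]
proof (rule Inf_greatest, safe)
  fix h assume h: "ising_mgf V E J lam h = 0"
  show "alpha1 V E Jt lam \<le> ereal (cmod h)"
  proof (rule ccontr)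
    assume "\<not> alpha1 V E Jt lam \<le> ereal (cmod h)"
    then have less: "ereal (cmod (- \<i> * h)) < alpha1 V E Jt lam"
      by (simp add: norm_mult)
    let ?lam = "\<lambda>u. if u \<in> V then lam u else 0"
    have "eval_fps (partition_fps ?lam (edge_coupling E J) V) (- \<i> * h) \<noteq> 0"
    \<comment> \<open>The disc has radius \<open>alpha1 V E Jt lam\<close>, possibly infinite; a
      zero inside it would contradict the infimum, since the rotation by i preserves the
      modulus.\<close>
    proof (rule partition_zero_free_disc_mono [OF _ _ _ _ _ less])
      fix z :: complex assume z: "ereal (norm z) < alpha1 V E Jt lam"
      show "eval_fps (partition_fps ?lam (edge_coupling E Jt) V) z \<noteq> 0"
      proof
        assume "eval_fps (partition_fps ?lam (edge_coupling E Jt) V) z = 0"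
        then have "ising_mgf V E Jt lam (\<i> * z) = 0"
          by (simp add: ising_mgf_eq_0_iff [OF assms(1)] mult.assoc [symmetric])
        then have "alpha1 V E Jt lam \<le> ereal (cmod (\<i> * z))"
          unfolding alpha1_def by (intro Inf_lower) blast
        then show False using z by (simp add: norm_mult)
      qed
    qed (use assms in \<open>auto simp: edge_coupling_def simple_graph_def\<close>)
    then show False
      using h by (simp add: ising_mgf_eq_0_iff [OF assms(1)])
  qed
qed

end
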